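(* Let $\omega$ be the symplectic form on $\mathcal{Z}_{\mathfrak{g}}$ and let $\nu:=\sum_{i=1}^r dz_i\wedge d\widehat{f}_i$ on $\mathbb{C}^r\times\mathcal{S}$. For the map $$\Phi:\mathbb{C}^r\times\mathcal{S}\rightarrow\mathcal{Z}_{\mathfrak{g}},\quad \Phi(\lambda,x)=\bigg(\exp\bigg(\sum_{i=1}^r\lambda_i(d_xf_i)^{\vee}\bigg),x\bigg),$$ we have $\Phi^*(\omega)=\nu$.
   Context: Everything is over $\mathbb{C}$. $\mathfrak{g}$ is a finite-dimensional semisimple Lie algebra of rank $r$ with adjoint group $G$, exponential map $\exp:\mathfrak{g}\to G$, and Killing form $\langle\cdot,\cdot\rangle$. For $x\in\mathfrak{g}$, $G_x$ is the $G$-stabilizer of $x$ under the adjoint action and $\mathfrak{g}_x=\{y\in\mathfrak{g}:[x,y]=0\}$. Fix homogeneous, algebraically independent generators $f_1,\ldots,f_r$ of $\mathbb{C}[\mathfrak{g}]^G$, a Cartan subalgebra $\mathfrak{t}\subseteq\mathfrak{g}$, simple roots $\Delta\subseteq\mathfrak{t}^*$, for each $\alpha\in\Delta$ root vectors $e_{\pm\alpha}\in\mathfrak{g}_{\pm\alpha}$ with $\langle e_\alpha,e_{-\alpha}\rangle=1$, and the $\mathfrak{sl}_2$-triple $(\xi,h,\eta)$ with $h\in\mathfrak{t}$ defined by $\alpha(h)=-2$ for all $\alpha\in\Delta$, $\xi=\sum_{\alpha\in\Delta}e_{-\alpha}$, $\eta=\sum_{\alpha\in\Delta}c_\alpha e_\alpha$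 for suitable $c_\alpha\in\mathbb{C}^\times$. Put $\mathcal{S}:=\xi+\mathfrak{g}_\eta$. The universal centralizer is $\mathcal{Z}_{\mathfrak{g}}:=\{(g,x)\in G\times\mathcal{S}:g\in G_x\}$, a smooth closed $2r$-dimensional subvariety of $G\times\mathfrak{g}$, with symplectic form $\omega$ the restriction of the symplectic form $\Omega$ on $G\times\mathfrak{g}$ given by $$\Omega_{(g,x)}\big((d_eL_g(y_1),z_1),(d_eL_g(y_2),z_2)\big)=\langle y_1,z_2\rangle-\langle y_2,z_1\rangle+\langle x,[y_1,y_2]\rangle,\quad y_i,z_i\in\mathfrak{g},$$ where $L_g$ is left translation by $g$. For $x\in\mathfrak{g}$, $(d_xf_i)^\vee\in\mathfrak{g}$ is the vector determined by $\langle(d_xf_i)^\vee,z\rangle=d_xf_i(z)$ for all $z\in\mathfrak{g}$; it is known to lie in $\mathfrak{g}_x$. $z_1,\ldots,z_r$ are the standard coordinates on $\mathbb{C}^r$ and $\widehat{f}_i:=f_i\big\vert_{\mathcal{S}}$. By a theorem of Kostant $(\widehat{f}_1,\ldots,\widehat{f}_r):\mathcal{S}\to\mathbb{C}^r$ is an isomorphism of varieties, so $z_1,\ldots,z_r,\widehat{f}_1,\ldots,\widehat{f}_r$ (pulled back along the projections) are global coordinates on $\mathbb{C}^r\times\mathcal{S}$. *)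

theory Defs
  imports "HOL-Analysis.Analysis"
begin

text \<open>
  A finite-dimensional complex Lie algebra is modelled, after the choice of a basis, as a bracket
  on \<open>complex ^ 'n\<close>.  Endomorphisms of it are matrices, so the adjoint group is a set of matrices,
  and \<open>complex ^ 'n\<close> and \<open>complex ^ 'n ^ 'n\<close> carry their usual normed topology.
\<close>

type_synonym 'n bracket = "complex ^ 'n \<Rightarrow> complex ^ 'n \<Rightarrow> complex ^ 'n"

section \<open>Semisimple Lie algebras\<close>

definition lie_algebra :: "'n::finite bracket \<Rightarrow> bool" where
  "lie_algebra br \<longleftrightarrow>
     (\<forall>x. Vector_Spaces.linear (*s) (*s) (\<lambda>y. br x y)) \<and>
     (\<forall>y. Vector_Spaces.linear (*s) (*s) (\<lambda>x. br x y)) \<and>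
     (\<forall>x. br x x = 0) \<and>
     (\<forall>x y z. br x (br y z) + br y (br z x) + br z (br x y) = 0)"

definition lie_ideal :: "'n::finite bracket \<Rightarrow> (complex ^ 'n) set \<Rightarrow> bool" where
  "lie_ideal br I \<longleftrightarrow> vec.subspace I \<and> (\<forall>x. \<forall>y\<in>I. br x y \<in> I)"

definition derived_subalgebra :: "'n::finite bracket \<Rightarrow> (complex ^ 'n) set \<Rightarrow> (complex ^ 'n) set" where
  "derived_subalgebra br A = vec.span {br x y | x y. x \<in> A \<and> y \<in> A}"

definition solvable_subalgebra :: "'n::finite bracket \<Rightarrow> (complex ^ 'n) set \<Rightarrow> bool" where
  "solvable_subalgebra br A \<longleftrightarrow> (\<exists>k. (derived_subalgebra br ^^ k) A = {0})"

definition semisimple_lie_algebra :: "'n::finite bracket \<Rightarrow> bool" where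
  "semisimple_lie_algebra br \<longleftrightarrow> lie_algebra br \<and>
     (\<forall>I. lie_ideal br I \<and> solvable_subalgebra br I \<longrightarrow> I = {0})"

definition ad :: "'n::finite bracket \<Rightarrow> complex ^ 'n \<Rightarrow> complex ^ 'n ^ 'n" where
  "ad br x = matrix (br x)"

definition killing :: "'n::finite bracket \<Rightarrow> complex ^ 'n \<Rightarrow> complex ^ 'n \<Rightarrow> complex" where
  "killing br x y = trace (ad br x ** ad br y)"

definition centralizer :: "'n::finite bracket \<Rightarrow> complex ^ 'n \<Rightarrow> (complex ^ 'n) set" where
  "centralizer br x = {y. br x y = 0}"


section \<open>The adjoint group\<close>

definition matrix_exp :: "complex ^ 'n ^ 'n \<Rightarrow> complex ^ 'n ^ ('n::finite)" where
  "matrix_exp A = (\<Sum>k. (1 / fact k) *\<^sub>R ((**) A ^^ k) (mat 1))"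

text \<open>The exponential map of the adjoint group, whose Lie algebra is \<open>ad \<gg>\<close>, identified
  with \<open>\<gg>\<close> through \<open>ad\<close>.\<close>

definition lie_exp :: "'n::finite bracket \<Rightarrow> complex ^ 'n \<Rightarrow> complex ^ 'n ^ 'n" where
  "lie_exp br y = matrix_exp (ad br y)"

text \<open>The connected subgroup of \<open>GL(\<gg>)\<close> with Lie algebra \<open>ad \<gg>\<close>, that is, the subgroup
  generated by \<open>exp (ad \<gg>)\<close>.  No rule for inverses is needed, because
  \<open>exp (ad (- y))\<close> is the inverse of \<open>exp (ad y)\<close>.\<close>

inductive_set adjoint_group :: "'n::finite bracket \<Rightarrow> (complex ^ 'n ^ 'n) set"
  for br :: "'n::finite bracket" where
  one: "mat 1 \<in> adjoint_group br"
| step: "A \<in> adjoint_group br \<Longrightarrow> lie_exp br y ** A \<in> adjoint_group br"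

definition group_stabilizer :: "'n::finite bracket \<Rightarrow> complex ^ 'n \<Rightarrow> (complex ^ 'n ^ 'n) set" where
  "group_stabilizer br x = {g \<in> adjoint_group br. g *v x = x}"


section \<open>Invariant polynomials\<close>

text \<open>Polynomials over the infinite field \<open>\<complex>\<close> are identified with polynomial functions.\<close>

inductive poly_fun :: "(complex ^ 'n::finite \<Rightarrow> complex) \<Rightarrow> bool" where
  const: "poly_fun (\<lambda>x. c)"
| coord: "poly_fun (\<lambda>x. x $ i)"
| add: "poly_fun p \<Longrightarrow> poly_fun q \<Longrightarrow> poly_fun (\<lambda>x. p x + q x)"
| mult: "poly_fun p \<Longrightarrow> poly_fun q \<Longrightarrow> poly_fun (\<lambda>x. p x * q x)"

definition invariant_poly :: "'n::finite bracket \<Rightarrow> (complex ^ 'n \<Rightarrow> complex) \<Rightarrow> bool" where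
  "invariant_poly br p \<longleftrightarrow> poly_fun p \<and> (\<forall>g\<in>adjoint_group br. \<forall>x. p (g *v x) = p x)"

definition homogeneous :: "(complex ^ 'n::finite \<Rightarrow> complex) \<Rightarrow> bool" where
  "homogeneous p \<longleftrightarrow> (\<exists>d::nat. \<forall>c x. p (c *s x) = c ^ d * p x)"

definition algebraically_independent :: "('r::finite \<Rightarrow> complex ^ 'n::finite \<Rightarrow> complex) \<Rightarrow> bool" where
  "algebraically_independent f \<longleftrightarrow>
     (\<forall>P :: complex ^ 'r \<Rightarrow> complex.
        poly_fun P \<and> (\<forall>x. P (\<chi> i. f i x) = 0) \<longrightarrow> (\<forall>z. P z = 0))"

definition invariants_generated_by ::
  "'n::finite bracket \<Rightarrow> ('r::finite \<Rightarrow> complex ^ 'n \<Rightarrow> complex) \<Rightarrow> bool" where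
  "invariants_generated_by br f \<longleftrightarrow> (\<forall>i. invariant_poly br (f i)) \<and>
     (\<forall>p. invariant_poly br p \<longrightarrow>
        (\<exists>P :: complex ^ 'r \<Rightarrow> complex. poly_fun P \<and> p = (\<lambda>x. P (\<chi> i. f i x))))"


section \<open>Cartan subalgebras, simple roots\<close>

definition abelian_subalgebra :: "'n::finite bracket \<Rightarrow> (complex ^ 'n) set \<Rightarrow> bool" where
  "abelian_subalgebra br A \<longleftrightarrow> vec.subspace A \<and> (\<forall>x\<in>A. \<forall>y\<in>A. br x y = 0)"

text \<open>Eigenvectors of \<open>ad x\<close> span the Lie algebra.\<close>

definition ad_semisimple :: "'n::finite bracket \<Rightarrow> complex ^ 'n \<Rightarrow> bool" where
  "ad_semisimple br x \<longleftrightarrow> vec.span {y. \<exists>c. br x y = c *s y} = UNIV"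

text \<open>Helgason's definition for a complex semisimple Lie algebra: a maximal abelian
  subalgebra all of whose elements are ad-semisimple.\<close>

definition cartan_subalgebra :: "'n::finite bracket \<Rightarrow> (complex ^ 'n) set \<Rightarrow> bool" where
  "cartan_subalgebra br t \<longleftrightarrow>
     abelian_subalgebra br t \<and>
     (\<forall>s. abelian_subalgebra br s \<and> t \<subseteq> s \<longrightarrow> s = t) \<and>
     (\<forall>h\<in>t. ad_semisimple br h)"

text \<open>An element of the dual of \<open>t\<close> is represented by a function on the whole space of which only the
  values on \<open>t\<close> matter.\<close>

definition root_space ::
  "'n::finite bracket \<Rightarrow> (complex ^ 'n) set \<Rightarrow> (complex ^ 'n \<Rightarrow> complex) \<Rightarrow> (complex ^ 'n) set" where
  "root_space br t \<alpha> = {y. \<forall>h\<in>t. br h y = \<alpha> h *s y}"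

definition is_root ::
  "'n::finite bracket \<Rightarrow> (complex ^ 'n) set \<Rightarrow> (complex ^ 'n \<Rightarrow> complex) \<Rightarrow> bool" where
  "is_root br t \<alpha> \<longleftrightarrow>
     (\<forall>h\<in>t. \<forall>k\<in>t. \<forall>a b. \<alpha> (a *s h + b *s k) = a * \<alpha> h + b * \<alpha> k) \<and>
     (\<exists>h\<in>t. \<alpha> h \<noteq> 0) \<and>
     (\<exists>y\<in>root_space br t \<alpha>. y \<noteq> 0)"

text \<open>Linear independence over \<open>t\<close> also makes distinct members of \<open>\<Delta>\<close> distinct as functionals
  on \<open>t\<close>.\<close>

definition simple_roots ::
  "'n::finite bracket \<Rightarrow> (complex ^ 'n) set \<Rightarrow> (complex ^ 'n \<Rightarrow> complex) set \<Rightarrow> bool" where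
  "simple_roots br t \<Delta> \<longleftrightarrow>
     finite \<Delta> \<and> (\<forall>\<alpha>\<in>\<Delta>. is_root br t \<alpha>) \<and>
     (\<forall>c. (\<forall>h\<in>t. (\<Sum>\<alpha>\<in>\<Delta>. c \<alpha> * \<alpha> h) = 0) \<longrightarrow> (\<forall>\<alpha>\<in>\<Delta>. c \<alpha> = 0)) \<and>
     (\<forall>\<beta>. is_root br t \<beta> \<longrightarrow>
        (\<exists>m :: (complex ^ 'n \<Rightarrow> complex) \<Rightarrow> nat.
           (\<forall>h\<in>t. \<beta> h = (\<Sum>\<alpha>\<in>\<Delta>. of_nat (m \<alpha>) * \<alpha> h)) \<or>
           (\<forall>h\<in>t. \<beta> h = - (\<Sum>\<alpha>\<in>\<Delta>. of_nat (m \<alpha>) * \<alpha> h))))"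

definition sl2_triple :: "'n::finite bracket \<Rightarrow> complex ^ 'n \<Rightarrow> complex ^ 'n \<Rightarrow> complex ^ 'n \<Rightarrow> bool" where
  "sl2_triple br \<xi> h \<eta> \<longleftrightarrow> br \<xi> \<eta> = h \<and> br h \<xi> = 2 *s \<xi> \<and> br h \<eta> = (- 2) *s \<eta>"

definition kostant_slice :: "'n::finite bracket \<Rightarrow> complex ^ 'n \<Rightarrow> complex ^ 'n \<Rightarrow> (complex ^ 'n) set" where
  "kostant_slice br \<xi> \<eta> = {\<xi> + y | y. y \<in> centralizer br \<eta>}"


section \<open>Forms on embedded submanifolds of a normed space\<close>

text \<open>A (smooth) submanifold is given as a subset \<open>M\<close> of a normed space and its tangent vectors are
  velocities of curves in \<open>M\<close>, hence elements of the ambient space.  A differential at a point of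
  \<open>M\<close> is the Frechet derivative within \<open>M\<close>; if it exists, its values at tangent vectors of \<open>M\<close>
  are uniquely determined.\<close>

definition tangent_space :: "'a::real_normed_vector set \<Rightarrow> 'a \<Rightarrow> 'a set" where
  "tangent_space M p =
     {v. \<exists>\<gamma>::real \<Rightarrow> 'a. \<gamma> 0 = p \<and> (\<forall>\<^sub>F s in nhds 0. \<gamma> s \<in> M) \<and>
           (\<gamma> has_vector_derivative v) (at 0)}"

definition differential ::
  "'a::real_normed_vector set \<Rightarrow> ('a \<Rightarrow> 'b::real_normed_vector) \<Rightarrow> 'a \<Rightarrow> 'a \<Rightarrow> 'b" where
  "differential M F p = frechet_derivative F (at p within M)"

definition wedge :: "('a \<Rightarrow> complex) \<Rightarrow> ('a \<Rightarrow> complex) \<Rightarrow> 'a \<Rightarrow> 'a \<Rightarrow> complex" where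
  "wedge a b u v = a u * b v - a v * b u"

type_synonym 'a two_form = "'a \<Rightarrow> 'a \<Rightarrow> 'a \<Rightarrow> complex"

definition restrict_form :: "'a::real_normed_vector set \<Rightarrow> 'a two_form \<Rightarrow> 'a two_form" where
  "restrict_form M \<Omega> p u v =
     (if p \<in> M \<and> u \<in> tangent_space M p \<and> v \<in> tangent_space M p then \<Omega> p u v else undefined)"

definition pullback_form ::
  "'a::real_normed_vector set \<Rightarrow> ('a \<Rightarrow> 'b::real_normed_vector) \<Rightarrow> 'b two_form \<Rightarrow> 'a two_form" where
  "pullback_form M F \<omega> p u v = \<omega> (F p) (differential M F p u) (differential M F p v)"

definition forms_agree_on :: "'a::real_normed_vector set \<Rightarrow> 'a two_form \<Rightarrow> 'a two_form \<Rightarrow> bool" where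
  "forms_agree_on M \<omega> \<nu> \<longleftrightarrow>
     (\<forall>p\<in>M. \<forall>u\<in>tangent_space M p. \<forall>v\<in>tangent_space M p. \<omega> p u v = \<nu> p u v)"


section \<open>The universal centralizer\<close>

definition universal_centralizer ::
  "'n::finite bracket \<Rightarrow> (complex ^ 'n) set \<Rightarrow> ((complex ^ 'n ^ 'n) \<times> (complex ^ 'n)) set" where
  "universal_centralizer br S =
     {(g, x). g \<in> adjoint_group br \<and> x \<in> S \<and> g \<in> group_stabilizer br x}"

text \<open>Left translation by \<open>g\<close> is the restriction of the linear map \<open>A \<mapsto> g A\<close> and \<open>y\<close> corresponds to
  the tangent vector \<open>ad y\<close> at the identity.  Hence \<open>d\<^sub>eL\<^sub>g(y)\<close> is the matrix \<open>g (ad y)\<close>; it determines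
  \<open>y\<close> because \<open>ad\<close> is injective.\<close>

definition d_left_translation :: "'n::finite bracket \<Rightarrow> complex ^ 'n ^ 'n \<Rightarrow> complex ^ 'n \<Rightarrow> complex ^ 'n ^ 'n" where
  "d_left_translation br g y = g ** ad br y"

definition left_trivialize :: "'n::finite bracket \<Rightarrow> complex ^ 'n ^ 'n \<Rightarrow> complex ^ 'n ^ 'n \<Rightarrow> complex ^ 'n" where
  "left_trivialize br g A = (THE y. d_left_translation br g y = A)"

definition Omega_form :: "'n::finite bracket \<Rightarrow> ((complex ^ 'n ^ 'n) \<times> (complex ^ 'n)) two_form" where
  "Omega_form br = (\<lambda>(g, x) (A\<^sub>1, z\<^sub>1) (A\<^sub>2, z\<^sub>2).
     let y\<^sub>1 = left_trivialize br g A\<^sub>1; y\<^sub>2 = left_trivialize br g A\<^sub>2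
     in killing br y\<^sub>1 z\<^sub>2 - killing br y\<^sub>2 z\<^sub>1 + killing br x (br y\<^sub>1 y\<^sub>2))"

definition omega_form ::
  "'n::finite bracket \<Rightarrow> (complex ^ 'n) set \<Rightarrow> ((complex ^ 'n ^ 'n) \<times> (complex ^ 'n)) two_form" where
  "omega_form br S = restrict_form (universal_centralizer br S) (Omega_form br)"

definition killing_dual :: "'n::finite bracket \<Rightarrow> (complex ^ 'n \<Rightarrow> complex) \<Rightarrow> complex ^ 'n" where
  "killing_dual br \<phi> = (THE v. \<forall>z. killing br v z = \<phi> z)"

definition Phi_map ::
  "'n::finite bracket \<Rightarrow> ('r::finite \<Rightarrow> complex ^ 'n \<Rightarrow> complex) \<Rightarrow>
   (complex ^ 'r) \<times> (complex ^ 'n) \<Rightarrow> (complex ^ 'n ^ 'n) \<times> (complex ^ 'n)" where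
  "Phi_map br f = (\<lambda>(l, x).
     (lie_exp br (\<Sum>i\<in>UNIV. (l $ i) *s killing_dual br (frechet_derivative (f i) (at x))), x))"

definition nu_form ::
  "('r::finite \<Rightarrow> complex ^ 'n::finite \<Rightarrow> complex) \<Rightarrow> (complex ^ 'n) set \<Rightarrow>
   ((complex ^ 'r) \<times> (complex ^ 'n)) two_form" where
  "nu_form f S p u v =
     (\<Sum>i\<in>UNIV. wedge (differential (UNIV \<times> S) (\<lambda>(l, x). l $ i) p)
                       (differential (UNIV \<times> S) (\<lambda>(l, x). f i x) p) u v)"

end

theory Submission
  imports Defs
begin

text \<open>
  Write \<open>Y = \<Sum>\<^sub>i \<lambda>\<^sub>i (d\<^sub>x f\<^sub>i)\<^sup>\<or>\<close>.  Duhamel's formula shows that the left logarithmic derivative of \<open>exp Y\<close> along a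
  tangent vector is \<open>\<integral>\<^sub>0\<^sup>1 Ad (exp (- t Y)) Y' dt\<close>, where \<open>Y'\<close> is the derivative of \<open>Y\<close>.  Invariance of the
  \<open>f\<^sub>i\<close> makes the gradients equivariant; hence they centralize \<open>x\<close>, commute with one another, and
  their derivative at \<open>x\<close> commutes with \<open>Ad (exp (t Y))\<close>.  Since \<open>Ad (exp Y)\<close> fixes \<open>x\<close>,
  differentiating that identity turns the bracket term of the symplectic form into a difference of
  Killing pairings, after which the pullback becomes an integral over \<open>[0, 1]\<close> whose integrand is
  constant, because the Hessians of the \<open>f\<^sub>i\<close> are symmetric.  The computation is valid at every
  point of \<open>\<complex>\<^sup>r \<times> \<gg>\<close>, so the slice enters only through its tangent vectors.

  Nondegeneracy of the Killing form does not need Cartan's criterion here.  The radical of the form is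
  an ideal that meets the Cartan subalgebra trivially, because \<open>\<langle>e\<^sub>\<alpha>, e\<^sub>-\<^sub>\<alpha>\<rangle> = 1\<close> forces the simple roots
  to vanish on the intersection.  It is therefore a module over the principal \<open>\<ss>\<ll>\<^sub>2\<close> with even
  weights and without weight zero, that is, zero.
\<close>

section \<open>The matrix exponential\<close>

lemma bounded_bilinear_matrix_mult:
  "bounded_bilinear ((**) :: complex ^ 'm ^ 'n \<Rightarrow> complex ^ 'p ^ 'm \<Rightarrow> complex ^ ('p::finite) ^ ('n::finite))"
  unfolding bilinear_conv_bounded_bilinear[symmetric] bilinear_def
  by (intro conjI allI linearI)
    (simp_all add: vec_eq_iff matrix_matrix_mult_def scaleR_sum_right sum.distrib distrib_left distrib_right)

lemma bounded_bilinear_matrix_vector_mult: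
  "bounded_bilinear ((*v) :: complex ^ 'm ^ 'n \<Rightarrow> complex ^ 'm \<Rightarrow> complex ^ ('n::finite))"
  unfolding bilinear_conv_bounded_bilinear[symmetric] bilinear_def
  by (intro conjI allI linearI)
    (simp_all add: vec_eq_iff matrix_vector_mult_def scaleR_sum_right sum.distrib distrib_left distrib_right)

interpretation mm: bounded_bilinear
  "(**) :: complex ^ 'm ^ 'n \<Rightarrow> complex ^ 'p ^ 'm \<Rightarrow> complex ^ ('p::finite) ^ ('n::finite)"
  by (rule bounded_bilinear_matrix_mult)

interpretation mv: bounded_bilinear
  "(*v) :: complex ^ 'm ^ 'n \<Rightarrow> complex ^ 'm \<Rightarrow> complex ^ ('n::finite)"
  by (rule bounded_bilinear_matrix_vector_mult)

text \<open>Many identities below are proved by showing that an expression in the time t has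
  derivative zero and then evaluating it at t = 0.\<close>

lemma constant_of_vector_derivative_zero:
  fixes g :: "real \<Rightarrow> 'a::real_normed_vector"
  assumes "\<And>t. (g has_vector_derivative 0) (at t)"
  shows "g s = g t"
  using has_derivative_zero_unique[of UNIV g s t] assms
  by (simp add: has_vector_derivative_def)

text \<open>One constant controls products and also the identity matrix, whose norm may exceed 1. It
  serves both the base and the inductive step of the power estimate.\<close>

lemma matrix_mult_norm_bound:
  "\<exists>K>0. (\<forall>(A :: complex ^ 'n ^ 'n::finite) (B :: complex ^ 'n ^ 'n). norm (A ** B) \<le> K * norm A * norm B) \<and>
     norm (mat 1 :: complex ^ 'n ^ 'n::finite) \<le> K"
proof -
  obtain K0 where K0: "K0 > 0"
    "\<And>(A :: complex ^ 'n ^ 'n) (B :: complex ^ 'n ^ 'n). norm (A ** B) \<le> norm A * norm B * K0"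
    using mm.pos_bounded by blast
  define K where "K = max K0 (norm (mat 1 :: complex ^ 'n ^ 'n))"
  have "norm (A ** B) \<le> K * norm A * norm B" for A B :: "complex ^ 'n ^ 'n"
  proof -
    have "norm A * norm B * K0 \<le> norm A * norm B * K"
      by (intro mult_left_mono) (auto simp: K_def)
    then show ?thesis using K0(2)[of A B] by (simp add: algebra_simps)
  qed
  then show ?thesis
    using K0(1) by (intro exI[of _ K]) (auto simp: K_def)
qed

text \<open>The k-th power of \<open>A\<close> has norm at most \<open>K * (K * norm A) ^ k\<close>,
  so a multiple of the scalar exponential series dominates the matrix series and bounds its
  sum.\<close>

lemma
  fixes A :: "complex ^ 'n ^ 'n::finite"
  assumes "K > 0" and K: "\<And>(A :: complex ^ 'n ^ 'n) (B :: complex ^ 'n ^ 'n). norm (A ** B) \<le> K * norm A * norm B"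
    and K1: "norm (mat 1 :: complex ^ 'n ^ 'n) \<le> K"
  shows summable_matrix_exp: "summable (\<lambda>k. (1 / fact k) *\<^sub>R ((**) A ^^ k) (mat 1))"
    and norm_matrix_exp_le: "norm (matrix_exp A) \<le> K * exp (K * norm A)"
proof -
  have pow: "norm (((**) A ^^ k) (mat 1)) \<le> K * (K * norm A) ^ k" for k
  proof (induction k)
    case (Suc k)
    have "norm (((**) A ^^ Suc k) (mat 1)) \<le> K * norm A * norm (((**) A ^^ k) (mat 1))"
      using K by simp
    also have "\<dots> \<le> K * norm A * (K * (K * norm A) ^ k)"
      using Suc \<open>K > 0\<close> by (intro mult_left_mono) auto
    finally show ?case by (simp add: algebra_simps)
  qed (simp add: K1)
  have le: "norm ((1 / fact k) *\<^sub>R ((**) A ^^ k) (mat 1)) \<le> K * ((K * norm A) ^ k /\<^sub>R fact k)" for k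
    using pow[of k] by (simp add: field_simps)
  have s: "summable (\<lambda>k. K * ((K * norm A) ^ k /\<^sub>R fact k))"
    using summable_exp_generic by (intro summable_mult)
  have sn: "summable (\<lambda>k. norm ((1 / fact k) *\<^sub>R ((**) A ^^ k) (mat 1)))"
    by (rule summable_comparison_test'[OF s, of 0]) (use le in simp)
  show "summable (\<lambda>k. (1 / fact k) *\<^sub>R ((**) A ^^ k) (mat 1))"
    by (rule summable_norm_cancel[OF sn])
  have "norm (matrix_exp A) \<le> (\<Sum>k. norm ((1 / fact k) *\<^sub>R ((**) A ^^ k) (mat 1)))"
    unfolding matrix_exp_def by (rule summable_norm[OF sn])
  also have "\<dots> \<le> (\<Sum>k. K * ((K * norm A) ^ k /\<^sub>R fact k))"
    by (rule suminf_le[OF le sn s])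
  also have "\<dots> = K * exp (K * norm A)"
    unfolding exp_def by (rule suminf_mult) (rule summable_exp_generic)
  finally show "norm (matrix_exp A) \<le> K * exp (K * norm A)" .
qed

lemma sums_matrix_exp:
  fixes A :: "complex ^ 'n ^ 'n::finite"
  shows "(\<lambda>k. (1 / fact k) *\<^sub>R ((**) A ^^ k) (mat 1)) sums matrix_exp A"
  unfolding matrix_exp_def
  using matrix_mult_norm_bound[where 'n='n] summable_matrix_exp[of _ A] by (blast intro: summable_sums)

lemma matrix_power_scaleR:
  fixes A :: "complex ^ 'n ^ 'n::finite"
  shows "((**) (s *\<^sub>R A) ^^ k) (mat 1) = s ^ k *\<^sub>R ((**) A ^^ k) (mat 1)"
proof (induction k)
  case (Suc k)
  have "((**) (s *\<^sub>R A) ^^ Suc k) (mat 1) = (s *\<^sub>R A) ** (((**) (s *\<^sub>R A) ^^ k) (mat 1))"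
    by (simp only: funpow.simps o_def)
  also have "\<dots> = s ^ Suc k *\<^sub>R (A ** (((**) A ^^ k) (mat 1)))"
    by (simp add: Suc mm.scaleR_left mm.scaleR_right)
  finally show ?case by (simp only: funpow.simps o_def)
qed simp

lemma matrix_exp_0 [simp]: "matrix_exp 0 = (mat 1 :: complex ^ 'n ^ 'n::finite)"
proof -
  have "(\<lambda>k. (1 / fact k) *\<^sub>R ((**) 0 ^^ k) (mat 1 :: complex ^ 'n ^ 'n)) =
        (\<lambda>k. if k = 0 then mat 1 else 0)"
    by (auto simp: fun_eq_iff mm.zero_left gr0_conv_Suc)
  with sums_matrix_exp[of "0 :: complex ^ 'n ^ 'n"]
  have "(\<lambda>k. if k = 0 then mat 1 else 0) sums (matrix_exp 0 :: complex ^ 'n ^ 'n)"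
    by simp
  from sums_unique2[OF this sums_single[of 0 "\<lambda>_. mat 1"]] show ?thesis .
qed

lemma matrix_exp_commute: "A ** matrix_exp A = matrix_exp A ** (A :: complex ^ 'n ^ 'n::finite)"
proof -
  have "A ** ((**) A ^^ k) (mat 1) = ((**) A ^^ k) (mat 1) ** A" for k
    by (induction k) (simp_all, metis matrix_mul_assoc)
  then have eq: "A ** ((1 / fact k) *\<^sub>R ((**) A ^^ k) (mat 1)) = ((1 / fact k) *\<^sub>R ((**) A ^^ k) (mat 1)) ** A" for k
    by (simp add: mm.scaleR_left mm.scaleR_right)
  show ?thesis
    using bounded_linear.sums[OF mm.bounded_linear_right[of A] sums_matrix_exp[of A]]
      bounded_linear.sums[OF mm.bounded_linear_left[of A] sums_matrix_exp[of A]]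
    unfolding eq by (rule sums_unique2)
qed

text \<open>Each entry of the exponential of t A is an everywhere convergent complex power series,
  restricted to real t. It is differentiated term by term, and the matrix statement is reassembled
  from the entries.\<close>

lemma has_vector_derivative_matrix_exp:
  fixes A :: "complex ^ 'n ^ 'n::finite"
  shows "((\<lambda>t. matrix_exp (t *\<^sub>R A)) has_vector_derivative A ** matrix_exp (t *\<^sub>R A)) (at t)"
proof -
  have entry: "((\<lambda>t. matrix_exp (t *\<^sub>R A) $ i $ j) has_vector_derivative (A ** matrix_exp (t *\<^sub>R A)) $ i $ j) (at t)"
    for i j
  proof -
    define P where "P k = (1 / fact k) *\<^sub>R ((**) A ^^ k) (mat 1) $ i $ j" for k
    have bl: "bounded_linear (\<lambda>M :: complex ^ 'n ^ 'n. M $ i $ j)"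
      using bounded_linear_compose[OF bounded_linear_vec_nth bounded_linear_vec_nth] .
    have P: "(\<lambda>k. P k * of_real s ^ k) sums (matrix_exp (s *\<^sub>R A) $ i $ j)" for s :: real
      using bounded_linear.sums[OF bl sums_matrix_exp[of "s *\<^sub>R A"]]
      by (simp add: matrix_power_scaleR P_def scaleR_conv_of_real[where 'a=complex] mult_ac flip: of_real_power)
    \<comment> \<open>Convergence at the real point \<open>norm z + 1\<close> gives convergence at
      every point of smaller modulus, in particular at \<open>z\<close>.\<close>
    have sm: "summable (\<lambda>k. P k * z ^ k)" for z :: complex
      by (rule powser_inside[where x="of_real (norm z + 1)"]) (use P[of "norm z + 1"] in \<open>simp_all add: sums_iff\<close>)
    have "((\<lambda>z. \<Sum>k. P k * z ^ k) has_field_derivative (\<Sum>k. diffs P k * of_real t ^ k)) (at (of_real t))"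
      by (rule termdiffs_strong_converges_everywhere[OF sm])
    then have "((\<lambda>s. \<Sum>k. P k * of_real s ^ k) has_vector_derivative (\<Sum>k. diffs P k * of_real t ^ k)) (at t)"
      by (rule has_vector_derivative_real_field)
    moreover have "(\<lambda>s. \<Sum>k. P k * of_real s ^ k) = (\<lambda>s. matrix_exp (s *\<^sub>R A) $ i $ j)"
      using P by (simp add: sums_iff fun_eq_iff)
    moreover have "(\<lambda>k. diffs P k * of_real t ^ k) sums ((A ** matrix_exp (t *\<^sub>R A)) $ i $ j)"
    proof -
      have "(\<lambda>k. (A ** ((1 / fact k) *\<^sub>R ((**) (t *\<^sub>R A) ^^ k) (mat 1))) $ i $ j)
         sums ((A ** matrix_exp (t *\<^sub>R A)) $ i $ j)"
        by (intro bounded_linear.sums[OF bl] bounded_linear.sums[OF mm.bounded_linear_right] sums_matrix_exp)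
      \<comment> \<open>The factor k + 1 in \<open>diffs\<close> turns 1/(k+1)! into 1/k!, and the
        surplus power of A becomes the left factor.\<close>
      moreover have "(A ** ((1 / fact k) *\<^sub>R ((**) (t *\<^sub>R A) ^^ k) (mat 1))) $ i $ j = diffs P k * of_real t ^ k" for k
        by (simp add: matrix_power_scaleR P_def diffs_def mm.scaleR_right scaleR_conv_of_real[where 'a=complex] field_simps
            del: of_nat_Suc)
      ultimately show ?thesis by simp
    qed
    ultimately show ?thesis by (simp add: sums_iff)
  qed
  show ?thesis
    unfolding has_vector_derivative_def has_derivative_componentwise_within[of "\<lambda>t. matrix_exp (t *\<^sub>R A)"]
  proof
    fix b :: "complex ^ 'n ^ 'n" assume "b \<in> Basis"
    then obtain i j u where b: "b = axis i (axis j u)" by (auto simp: Basis_vec_def)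
    have "((\<lambda>t. matrix_exp (t *\<^sub>R A) $ i $ j \<bullet> u) has_derivative (\<lambda>s. (s *\<^sub>R (A ** matrix_exp (t *\<^sub>R A)) $ i $ j) \<bullet> u)) (at t)"
      using entry[of i j] unfolding has_vector_derivative_def by (rule has_derivative_inner_left)
    then show "((\<lambda>t. matrix_exp (t *\<^sub>R A) \<bullet> b) has_derivative (\<lambda>s. (s *\<^sub>R (A ** matrix_exp (t *\<^sub>R A))) \<bullet> b)) (at t)"
      by (simp add: b inner_axis)
  qed
qed

lemma matrix_exp_commute_scaleR:
  "A ** matrix_exp (t *\<^sub>R A) = matrix_exp (t *\<^sub>R A) ** (A :: complex ^ 'n ^ 'n::finite)"
  using matrix_exp_commute[of "t *\<^sub>R A"]
  by (cases "t = 0") (simp_all add: mm.scaleR_left mm.scaleR_right)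

lemma has_vector_derivative_matrix_exp_uminus:
  fixes A :: "complex ^ 'n ^ 'n::finite"
  shows "((\<lambda>t. matrix_exp ((- t) *\<^sub>R A)) has_vector_derivative - (A ** matrix_exp ((- t) *\<^sub>R A))) (at t)"
  using has_vector_derivative_matrix_exp[of "- A" t]
  by (simp add: mm.minus_left)

lemma matrix_exp_minus_left:
  "matrix_exp ((- t) *\<^sub>R A) ** matrix_exp (t *\<^sub>R A) = (mat 1 :: complex ^ 'n ^ 'n::finite)"
proof -
  have "((\<lambda>t. matrix_exp ((- t) *\<^sub>R A) ** matrix_exp (t *\<^sub>R A)) has_vector_derivative 0) (at t)" for t
    using mm.has_vector_derivative[OF has_vector_derivative_matrix_exp_uminus[of A t] has_vector_derivative_matrix_exp[of A t]]
    by (simp add: mm.minus_left matrix_mul_assoc matrix_exp_commute_scaleR[of A "-t", simplified])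
  from constant_of_vector_derivative_zero[OF this, of t 0] show ?thesis by simp
qed

lemma matrix_exp_minus_right:
  "matrix_exp (t *\<^sub>R A) ** matrix_exp ((- t) *\<^sub>R A) = (mat 1 :: complex ^ 'n ^ 'n::finite)"
  using matrix_exp_minus_left[of "- t" A] by simp

text \<open>The product of exp (-t A) and exp ((s + t) A) is constant in t, hence equal to exp (s
  A); left multiplication by exp (t A) then gives the claim.\<close>

lemma matrix_exp_add:
  "matrix_exp (t *\<^sub>R A) ** matrix_exp (s *\<^sub>R A) = (matrix_exp ((s + t) *\<^sub>R A) :: complex ^ 'n ^ 'n::finite)"
proof -
  have d: "((\<lambda>t. matrix_exp ((s + t) *\<^sub>R A)) has_vector_derivative A ** matrix_exp ((s + t) *\<^sub>R A)) (at t)" for t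
  proof -
    have "((\<lambda>t. s + t) has_vector_derivative 1) (at t)" by (auto intro!: derivative_eq_intros)
    from vector_diff_chain_at[OF this has_vector_derivative_matrix_exp] show ?thesis by (simp add: o_def)
  qed
  have "((\<lambda>t. matrix_exp ((- t) *\<^sub>R A) ** matrix_exp ((s + t) *\<^sub>R A)) has_vector_derivative 0) (at t)" for t
    using mm.has_vector_derivative[OF has_vector_derivative_matrix_exp_uminus[of A t] d[of t]]
    by (simp add: mm.minus_left matrix_mul_assoc matrix_exp_commute_scaleR[of A "-t", simplified])
  from constant_of_vector_derivative_zero[OF this, of t 0]
  have "matrix_exp (t *\<^sub>R A) ** (matrix_exp ((- t) *\<^sub>R A) ** matrix_exp ((s + t) *\<^sub>R A)) = matrix_exp (t *\<^sub>R A) ** matrix_exp (s *\<^sub>R A)"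
    by simp
  then show ?thesis
    by (metis matrix_mul_assoc matrix_exp_minus_right matrix_mul_lid)
qed

lemma matrix_exp_fixes:
  assumes "A *v x = 0"
  shows "matrix_exp (t *\<^sub>R A) *v x = (x :: complex ^ 'n::finite)"
proof -
  have "((\<lambda>t. matrix_exp (t *\<^sub>R A) *v x) has_vector_derivative 0) (at t)" for t
    using bounded_linear.has_vector_derivative[OF mv.bounded_linear_left has_vector_derivative_matrix_exp[of A t], of x]
    by (simp add: matrix_exp_commute_scaleR assms mv.zero_right flip: matrix_vector_mul_assoc)
  from constant_of_vector_derivative_zero[OF this, of t 0] show ?thesis by simp
qed

text \<open>The remainder estimate for the derivative needs a single bound for all \<open>B\<close>
  near \<open>A\<close> and for times of both signs.\<close>

lemma matrix_exp_bounded_nhd: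
  fixes A :: "complex ^ 'n ^ 'n::finite"
  shows "\<exists>M>0. \<forall>B t. norm (B - A) \<le> 1 \<longrightarrow> \<bar>t\<bar> \<le> 1 \<longrightarrow> norm (matrix_exp (t *\<^sub>R B)) \<le> M"
proof -
  obtain K where K: "K > 0"
    "\<And>(A :: complex ^ 'n ^ 'n) (B :: complex ^ 'n ^ 'n). norm (A ** B) \<le> K * norm A * norm B"
    "norm (mat 1 :: complex ^ 'n ^ 'n) \<le> K"
    using matrix_mult_norm_bound by blast
  have "norm (matrix_exp (t *\<^sub>R B)) \<le> K * exp (K * (norm A + 1))"
    if "norm (B - A) \<le> 1" "\<bar>t\<bar> \<le> 1" for B :: "complex ^ 'n ^ 'n" and t
  proof -
    have "norm B \<le> norm A + 1"
      using norm_triangle_ineq[of A "B - A"] that(1) by simp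
    then have "norm (t *\<^sub>R B) \<le> norm A + 1"
      using mult_mono[of "\<bar>t\<bar>" 1 "norm B" "norm A + 1"] that(2) by simp
    then have "K * exp (K * norm (t *\<^sub>R B)) \<le> K * exp (K * (norm A + 1))"
      using K(1) by simp
    with norm_matrix_exp_le[OF K, of "t *\<^sub>R B"] show ?thesis by linarith
  qed
  with K(1) show ?thesis by (intro exI[of _ "K * exp (K * (norm A + 1))"]) simp
qed

section \<open>Duhamel's formula for the derivative of the matrix exponential\<close>

lemma continuous_on_matrix_exp_scaleR [continuous_intros]:
  fixes A :: "complex ^ 'n ^ 'n::finite"
  assumes "continuous_on T g"
  shows "continuous_on T (\<lambda>t. matrix_exp (g t *\<^sub>R A))"
proof -
  have "continuous_on UNIV (\<lambda>t. matrix_exp (t *\<^sub>R A))"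
    using has_vector_derivative_continuous[OF has_vector_derivative_matrix_exp[of A]]
    by (intro continuous_at_imp_continuous_on ballI)
  from continuous_on_compose2[OF this assms] show ?thesis by simp
qed

lemmas continuous_on_matrix_mult [continuous_intros] = mm.continuous_on
lemmas continuous_on_matrix_vector_mult [continuous_intros] = mv.continuous_on

text \<open>Duhamel's integral: exp (-A) times the derivative of exp at \<open>A\<close> in
  direction \<open>H\<close>. Formally it is (1 - exp (-ad A)) / ad A applied to \<open>H\<close>,
  with ad A the matrix commutator.\<close>

definition exp_average :: "complex ^ 'n ^ 'n \<Rightarrow> complex ^ 'n ^ 'n \<Rightarrow> complex ^ 'n ^ ('n::finite)" where
  "exp_average A H = integral {0..1} (\<lambda>t. matrix_exp ((- t) *\<^sub>R A) ** H ** matrix_exp (t *\<^sub>R A))"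

lemma exp_average_integrable:
  fixes A H B :: "complex ^ 'n ^ 'n::finite"
  shows "(\<lambda>t. matrix_exp ((- t) *\<^sub>R A) ** H ** matrix_exp (t *\<^sub>R B)) integrable_on {0..1}"
  by (intro integrable_continuous_interval continuous_intros)

lemma bounded_linear_exp_average: "bounded_linear (exp_average (A :: complex ^ 'n ^ 'n::finite))"
  unfolding linear_conv_bounded_linear[symmetric]
proof (rule linearI)
  show "exp_average A (x + y) = exp_average A x + exp_average A y" for x y
    unfolding exp_average_def mm.add_left mm.add_right
    by (intro integral_add exp_average_integrable)
  show "exp_average A (r *\<^sub>R x) = r *\<^sub>R exp_average A x" for r x
    unfolding exp_average_def mm.scaleR_left mm.scaleR_right by (rule integral_cmul)
qed

text \<open>The curve starts at the identity and reaches exp (-A) exp (B) at time 1, so integrating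
  its derivative compares the two exponentials exactly.\<close>

lemma has_vector_derivative_matrix_exp_quotient:
  fixes A B :: "complex ^ 'n ^ 'n::finite"
  shows "((\<lambda>t. matrix_exp ((- t) *\<^sub>R A) ** matrix_exp (t *\<^sub>R B)) has_vector_derivative
     matrix_exp ((- t) *\<^sub>R A) ** (B - A) ** matrix_exp (t *\<^sub>R B)) (at t within S)"
proof -
  have "((\<lambda>t. matrix_exp ((- t) *\<^sub>R A) ** matrix_exp (t *\<^sub>R B)) has_vector_derivative
     matrix_exp ((- t) *\<^sub>R A) ** (B - A) ** matrix_exp (t *\<^sub>R B)) (at t)"
    using mm.has_vector_derivative[OF has_vector_derivative_matrix_exp_uminus[of A t] has_vector_derivative_matrix_exp[of B t]]
    by (simp add: mm.minus_left mm.diff_left mm.diff_right matrix_mul_assoc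
        matrix_exp_commute_scaleR[of A "-t", simplified])
  then show ?thesis by (rule has_vector_derivative_at_within)
qed

text \<open>Replacing exp (t B) by exp (t A) in the integral formula for exp (-A) exp (B) - 1 leaves
  \<open>exp_average A (B - A)\<close>. The error is quadratic in \<open>B - A\<close>, because the
  integrand already contains one factor \<open>B - A\<close> and exp (t B) - exp (t A) contributes
  another.\<close>

lemma has_derivative_matrix_exp:
  fixes A :: "complex ^ 'n ^ 'n::finite"
  shows "(matrix_exp has_derivative (\<lambda>H. matrix_exp A ** exp_average A H)) (at A)"
proof -
  obtain M where M: "M > 0"
    "\<And>B t. norm (B - A) \<le> 1 \<Longrightarrow> \<bar>t\<bar> \<le> 1 \<Longrightarrow> norm (matrix_exp (t *\<^sub>R B)) \<le> M"
    using matrix_exp_bounded_nhd[of A] by blast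
  obtain K where K: "K > 0"
    "\<And>(A :: complex ^ 'n ^ 'n) (B :: complex ^ 'n ^ 'n). norm (A ** B) \<le> K * norm A * norm B"
    using matrix_mult_norm_bound by blast
  have K3: "norm (X ** Y ** Z) \<le> K * (K * x * y) * z"
    if "norm X \<le> x" "norm Y \<le> y" "norm Z \<le> z" for X Y Z :: "complex ^ 'n ^ 'n" and x y z
  proof -
    have nn: "0 \<le> x" "0 \<le> y" "0 \<le> z" using that norm_ge_zero order_trans by blast+
    have "K * norm X * norm Y \<le> K * x * y"
      using that nn K(1) by (intro mult_mono) auto
    then have "norm (X ** Y) \<le> K * x * y" using K(2)[of X Y] by linarith
    then have "K * norm (X ** Y) * norm Z \<le> K * (K * x * y) * z"
      using that nn K(1) by (intro mult_mono) auto
    then show ?thesis using K(2)[of "X ** Y" Z] by linarith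
  qed
  \<comment> \<open>\<open>C1 * norm (B - A)\<close> bounds the derivative of the quotient curve.
    \<open>C2\<close> comes from the same triple product after its last factor is replaced by exp (t
    B) - exp (t A), of norm at most \<open>K * M * (C1 * norm (B - A))\<close>.\<close>
  define C1 where "C1 = K * K * M * M"
  define C2 where "C2 = K * K * M * K * M * C1"
  have C2: "C2 > 0" "C1 > 0" using K M by (simp_all add: C1_def C2_def)
  have A0: "norm (matrix_exp (t *\<^sub>R A)) \<le> M" if "\<bar>t\<bar> \<le> 1" for t using M(2)[of A] that by simp
  have near: "norm (matrix_exp ((-1) *\<^sub>R A) ** matrix_exp B - mat 1 - exp_average A (B - A)) \<le> C2 * (norm (B - A))\<^sup>2"
    if B: "norm (B - A) \<le> 1" for B
  proof -
    let ?G = "\<lambda>t. matrix_exp ((- t) *\<^sub>R A) ** matrix_exp (t *\<^sub>R B)"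
    let ?G' = "\<lambda>t. matrix_exp ((- t) *\<^sub>R A) ** (B - A) ** matrix_exp (t *\<^sub>R B)"
    have G: "(?G has_vector_derivative ?G' t) (at t within S)" for t S
      by (rule has_vector_derivative_matrix_exp_quotient)
    have int: "(?G' has_integral ?G 1 - ?G 0) {0..1}"
      by (rule fundamental_theorem_of_calculus) (use G in auto)
    have "norm (?G' t) \<le> C1 * norm (B - A)" if "t \<in> {0..1}" for t
      using K3[OF A0[of "-t"] order_refl M(2)[OF B, of t], of "B - A"] that
      by (simp add: C1_def mult_ac)
    then have G1: "norm (?G t - ?G 0) \<le> C1 * norm (B - A)" if "t \<in> {0..1}" for t
    proof -
      have "norm (?G t - ?G 0) \<le> C1 * norm (B - A) * norm (t - 0)"
      proof (rule differentiable_bound[of "{0..1}" ?G "\<lambda>t s. s *\<^sub>R ?G' t"])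
        show "onorm (\<lambda>s. s *\<^sub>R ?G' x) \<le> C1 * norm (B - A)" if "x \<in> {0..1}" for x
          using \<open>\<And>t. t \<in> {0..1} \<Longrightarrow> norm (?G' t) \<le> C1 * norm (B - A)\<close>[OF that]
          by (simp add: onorm_scaleR_left bounded_linear_ident onorm_id)
      qed (use G that in \<open>auto simp: has_vector_derivative_def\<close>)
      also have "\<dots> \<le> C1 * norm (B - A)"
        using that C2 by (intro mult_left_le) auto
      finally show ?thesis .
    qed
    have EB: "norm (matrix_exp (t *\<^sub>R B) - matrix_exp (t *\<^sub>R A)) \<le> K * M * (C1 * norm (B - A))"
      if "t \<in> {0..1}" for t
    proof -
      have "matrix_exp (t *\<^sub>R B) - matrix_exp (t *\<^sub>R A) = matrix_exp (t *\<^sub>R A) ** (?G t - ?G 0)"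
        by (simp add: mm.diff_right matrix_mul_assoc matrix_exp_minus_right[of t A, simplified])
      also have "norm \<dots> \<le> K * norm (matrix_exp (t *\<^sub>R A)) * norm (?G t - ?G 0)" by (rule K(2))
      also have "\<dots> \<le> K * M * (C1 * norm (B - A))"
        using G1[OF that] A0[of t] that K(1) M(1) by (intro mult_mono) auto
      finally show ?thesis .
    qed
    let ?R = "\<lambda>t. ?G' t - matrix_exp ((- t) *\<^sub>R A) ** (B - A) ** matrix_exp (t *\<^sub>R A)"
    have "(?R has_integral ?G 1 - ?G 0 - exp_average A (B - A)) {0..1}"
      unfolding exp_average_def
      by (intro has_integral_diff int integrable_integral exp_average_integrable)
    moreover have "norm (?R t) \<le> C2 * (norm (B - A))\<^sup>2" if "t \<in> {0..1}" for t
      using K3[OF A0[of "-t"] order_refl EB[OF that], of "B - A"] that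
      by (simp add: C2_def mm.diff_right power2_eq_square mult_ac)
    ultimately show ?thesis
      using has_integral_bound_real[of "C2 * (norm (B - A))\<^sup>2" "{}" ?R _ 0 1] C2 by simp
  qed
  have E1: "matrix_exp A ** matrix_exp ((-1) *\<^sub>R A) = mat 1"
    using matrix_exp_minus_right[of 1 A] by simp
  have near2: "norm (matrix_exp B - matrix_exp A - matrix_exp A ** exp_average A (B - A)) \<le> (K * M * C2) * (norm (B - A))\<^sup>2"
    if B: "norm (B - A) \<le> 1" for B
  proof -
    have "matrix_exp B - matrix_exp A - matrix_exp A ** exp_average A (B - A) =
       matrix_exp A ** (matrix_exp ((-1) *\<^sub>R A) ** matrix_exp B - mat 1 - exp_average A (B - A))"
      by (simp add: mm.diff_right matrix_mul_assoc E1[simplified])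
    also have "norm \<dots> \<le> K * norm (matrix_exp A) * norm (matrix_exp ((-1) *\<^sub>R A) ** matrix_exp B - mat 1 - exp_average A (B - A))"
      by (rule K(2))
    also have "\<dots> \<le> K * M * (C2 * (norm (B - A))\<^sup>2)"
      using near[OF B] A0[of 1] K(1) M(1) by (intro mult_mono) auto
    finally show ?thesis by simp
  qed
  show ?thesis
    unfolding has_derivative_at_alt
  proof (intro conjI allI impI)
    show "bounded_linear (\<lambda>H. matrix_exp A ** exp_average A H)"
      by (intro bounded_linear_compose[OF mm.bounded_linear_right] bounded_linear_exp_average)
  next
    fix e :: real assume "e > 0"
    define c where "c = K * M * C2"
    have c: "c > 0" using K M C2 by (simp add: c_def)
    show "\<exists>d>0. \<forall>y. norm (y - A) < d \<longrightarrow>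
         norm (matrix_exp y - matrix_exp A - matrix_exp A ** exp_average A (y - A)) \<le> e * norm (y - A)"
    \<comment> \<open>The radius 1 keeps \<open>y\<close> where the quadratic estimate holds; e / c
      turns one of its two factors \<open>norm (y - A)\<close> into \<open>e\<close>.\<close>
    proof (intro exI[of _ "min 1 (e / c)"] conjI allI impI)
      fix y assume y: "norm (y - A) < min 1 (e / c)"
      then have "c * norm (y - A) \<le> e" using c by (simp add: field_simps)
      then have "c * (norm (y - A))\<^sup>2 \<le> e * norm (y - A)"
        by (simp add: power2_eq_square mult_right_mono flip: mult.assoc)
      with near2[of y] y show "norm (matrix_exp y - matrix_exp A - matrix_exp A ** exp_average A (y - A)) \<le> e * norm (y - A)"
        by (simp add: c_def)
    qed (use c \<open>e > 0\<close> in simp)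
  qed
qed

section \<open>Lie algebras\<close>

text \<open>The Lie algebra is complex while derivatives and integrals are real-linear; this
  equation links the two scalings.\<close>

lemma scaleR_eq_smult_vec: "r *\<^sub>R x = complex_of_real r *s x"
  by (simp add: vec_eq_iff scaleR_conv_of_real[where 'a=complex])

locale lie_alg =
  fixes br :: "'n::finite bracket"
  assumes lie: "lie_algebra br"
begin

lemma br_linear: "Vector_Spaces.linear (*s) (*s) (br x)" "Vector_Spaces.linear (*s) (*s) (\<lambda>x. br x y)"
  using lie unfolding lie_algebra_def by blast+

lemma br_smult_right: "br x (c *s y) = c *s br x y"
  using vec.linear_scale[OF br_linear(1)] .

lemma br_smult_left: "br (c *s x) y = c *s br x y"
  using vec.linear_scale[OF br_linear(2)] .

lemma bounded_bilinear_br: "bounded_bilinear br"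
  unfolding bilinear_conv_bounded_bilinear[symmetric] bilinear_def
  by (intro conjI allI linearI)
    (simp_all add: vec.linear_add[OF br_linear(1)] vec.linear_add[OF br_linear(2)]
      scaleR_eq_smult_vec br_smult_right br_smult_left)

sublocale br: bounded_bilinear br by (rule bounded_bilinear_br)

lemma br_self [simp]: "br x x = 0"
  using lie unfolding lie_algebra_def by blast

lemma br_skew: "br x y = - br y x"
proof -
  have "br (x + y) (x + y) = 0" by (rule br_self)
  then show ?thesis
    unfolding br.add_left br.add_right by (simp add: eq_neg_iff_add_eq_0 add.commute)
qed

lemma jacobi: "br x (br y z) = br (br x y) z + br y (br x z)"
proof -
  have "br x (br y z) + br y (br z x) + br z (br x y) = 0"
    using lie unfolding lie_algebra_def by blast
  moreover have "br y (br z x) = - br y (br x z)" "br z (br x y) = - br (br x y) z"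
    by (simp_all add: br_skew[of z] br.minus_right)
  ultimately show ?thesis by (simp add: algebra_simps)
qed

lemma ad_mult [simp]: "ad br x *v y = br x y"
  unfolding ad_def by (rule matrix_works[OF br_linear(1)])

lemma matrix_eqI: "(\<And>v. A *v v = B *v v) \<Longrightarrow> A = (B :: complex ^ 'n ^ 'n)"
  using matrix_eq[of A B] by simp

lemma ad_add: "ad br (x + y) = ad br x + ad br y"
  by (rule matrix_eqI) (simp add: mv.add_left br.add_left)

lemma ad_scaleR: "ad br (r *\<^sub>R x) = r *\<^sub>R ad br x"
  by (rule matrix_eqI) (simp add: mv.scaleR_left br.scaleR_left)

lemma bounded_linear_ad: "bounded_linear (ad br)"
  unfolding linear_conv_bounded_linear[symmetric] by (intro linearI ad_add ad_scaleR)

lemma ad_br: "ad br (br x y) = ad br x ** ad br y - ad br y ** ad br x"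
  by (rule matrix_eqI)
    (simp add: mv.diff_left jacobi[of x y] flip: matrix_vector_mul_assoc)

lemma killing_eq_sum: "killing br x y = (\<Sum>i\<in>UNIV. \<Sum>j\<in>UNIV. ad br x $ i $ j * ad br y $ j $ i)"
  by (simp add: killing_def trace_def matrix_matrix_mult_def)

lemma killing_sym: "killing br x y = killing br y x"
  unfolding killing_def by (rule trace_mul_sym)

lemma killing_smult_left: "killing br (c *s x) y = c * killing br x y"
proof -
  have "ad br (c *s x) $ i $ j = c * ad br x $ i $ j" for i j
    by (simp add: ad_def matrix_def br_smult_left)
  then show ?thesis by (simp add: killing_eq_sum sum_distrib_left mult.assoc)
qed

lemma killing_smult_right: "killing br x (c *s y) = c * killing br x y"
  using killing_smult_left killing_sym by metis

lemma bounded_bilinear_killing: "bounded_bilinear (killing br)"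
proof -
  have "linear (\<lambda>x. killing br x y)" for y
    by (intro linearI)
      (simp_all add: killing_eq_sum ad_add ad_scaleR distrib_right sum.distrib scaleR_sum_right)
  then show ?thesis
    unfolding bilinear_conv_bounded_bilinear[symmetric] bilinear_def
    by (simp add: killing_sym[of _ x for x] flip: killing_sym)
qed

sublocale killing: bounded_bilinear "killing br" by (rule bounded_bilinear_killing)

text \<open>Both sides are differences of traces of three \<open>ad\<close> matrices. One pair of
  terms agrees by associativity, the other by cyclicity of the trace.\<close>

lemma killing_invariant: "killing br (br x y) z = killing br x (br y z)"
proof -
  have "trace (ad br y ** ad br x ** ad br z) = trace (ad br x ** (ad br z ** ad br y))"
    using trace_mul_sym[of "ad br y" "ad br x ** ad br z"] by (simp add: matrix_mul_assoc)
  then show ?thesis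
    unfolding killing_def ad_br mm.diff_left mm.diff_right trace_sub
    by (simp add: matrix_mul_assoc)
qed

section \<open>One-parameter subgroups of the adjoint group, acting by automorphisms that preserve
  the Killing form\<close>

definition Ad :: "complex ^ 'n \<Rightarrow> real \<Rightarrow> complex ^ 'n ^ 'n" where
  "Ad y t = matrix_exp (t *\<^sub>R ad br y)"

lemma Ad_0 [simp]: "Ad y 0 = mat 1"
  by (simp add: Ad_def)

lemma Ad_1: "Ad y 1 = lie_exp br y"
  by (simp add: Ad_def lie_exp_def)

lemma Ad_minus_left: "Ad y (- t) ** Ad y t = mat 1"
  unfolding Ad_def by (rule matrix_exp_minus_left)

lemma Ad_minus_right: "Ad y t ** Ad y (- t) = mat 1"
  unfolding Ad_def by (rule matrix_exp_minus_right)

lemma Ad_minus_cancel [simp]: "Ad y (- t) *v (Ad y t *v x) = x" "Ad y t *v (Ad y (- t) *v x) = x"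
  by (simp_all add: matrix_vector_mul_assoc Ad_minus_left Ad_minus_right)

lemma Ad_add: "Ad y s *v (Ad y t *v x) = Ad y (s + t) *v x"
  by (simp add: Ad_def matrix_vector_mul_assoc matrix_exp_add add.commute)

lemma Ad_fixes: "br y x = 0 \<Longrightarrow> Ad y t *v x = x"
  unfolding Ad_def by (rule matrix_exp_fixes) simp

lemma Ad_in_adjoint_group: "Ad y t \<in> adjoint_group br"
  using adjoint_group.step[OF adjoint_group.one, of br "t *\<^sub>R y"]
  by (simp add: lie_exp_def Ad_def ad_scaleR)

lemma has_vector_derivative_Ad:
  "((\<lambda>t. Ad y t *v x) has_vector_derivative br y (Ad y t *v x)) (at t)"
  using bounded_linear.has_vector_derivative[OF mv.bounded_linear_left
      has_vector_derivative_matrix_exp[of "ad br y" t], of x]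
  unfolding Ad_def[symmetric] matrix_vector_mul_assoc[symmetric] ad_mult .

lemma continuous_on_Ad [continuous_intros]:
  "continuous_on T g \<Longrightarrow> continuous_on T (\<lambda>t. Ad y (g t))"
  unfolding Ad_def by (rule continuous_on_matrix_exp_scaleR)

lemma br_Ad_commute: "br y (Ad y t *v x) = Ad y t *v br y x"
  using arg_cong[OF matrix_exp_commute_scaleR[of "ad br y" t], of "\<lambda>A. A *v x"]
  by (simp add: Ad_def flip: matrix_vector_mul_assoc)

text \<open>Invariance of the form makes the two terms in the time derivative of the pairing
  cancel.\<close>

lemma killing_Ad: "killing br (Ad y t *v a) (Ad y t *v b) = killing br a b"
proof -
  have "((\<lambda>t. killing br (Ad y t *v a) (Ad y t *v b)) has_vector_derivative 0) (at t)" for t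
    using killing.has_vector_derivative[OF has_vector_derivative_Ad[of y a t] has_vector_derivative_Ad[of y b t]]
    by (simp add: killing_invariant[of "Ad y t *v a" y, symmetric] br_skew[of "Ad y t *v a"] killing.minus_left)
  from constant_of_vector_derivative_zero[OF this, of t 0] show ?thesis by simp
qed

lemma killing_Ad_left: "killing br (Ad y t *v a) b = killing br a (Ad y (- t) *v b)"
  using killing_Ad[of y t a "Ad y (- t) *v b"] by simp

text \<open>Pulling the bracket of the moved vectors back by \<open>Ad y (- t)\<close> gives a curve
  with zero derivative, since ad y is a derivation by the Jacobi identity.\<close>

lemma Ad_br: "Ad y t *v br a b = br (Ad y t *v a) (Ad y t *v b)"
proof -
  let ?g = "\<lambda>t. Ad y (- t) *v br (Ad y t *v a) (Ad y t *v b)"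
  have "(?g has_vector_derivative 0) (at t)" for t
  proof -
    have E: "((\<lambda>t. Ad y (- t)) has_vector_derivative - (ad br y ** Ad y (- t))) (at t)"
      unfolding Ad_def by (rule has_vector_derivative_matrix_exp_uminus)
    have "(?g has_vector_derivative
        Ad y (- t) *v (br (Ad y t *v a) (br y (Ad y t *v b)) + br (br y (Ad y t *v a)) (Ad y t *v b))
        + (- (ad br y ** Ad y (- t))) *v br (Ad y t *v a) (Ad y t *v b)) (at t)"
      by (intro mv.has_vector_derivative br.has_vector_derivative E has_vector_derivative_Ad)
    then show ?thesis
      by (simp add: mv.minus_left br_Ad_commute jacobi[of y] mv.add_right flip: matrix_vector_mul_assoc)
  qed
  from constant_of_vector_derivative_zero[OF this, of t 0]
  have "Ad y t *v ?g t = Ad y t *v br a b" by simp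
  then show ?thesis by simp
qed

lemma Ad_conj: "Ad y (- t) ** ad br z ** Ad y t = ad br (Ad y (- t) *v z)"
  by (rule matrix_eqI) (simp add: Ad_br flip: matrix_vector_mul_assoc)

text \<open>Conjugation by an automorphism carries \<open>ad br z\<close> to \<open>ad\<close> of
  the moved vector, and the linear map \<open>ad\<close> passes through the integral. The derivative
  of the exponential is thus a left translate of a Lie algebra element.\<close>

lemma exp_average_ad:
  "exp_average (ad br y) (ad br z) = ad br (integral {0..1} (\<lambda>t. Ad y (- t) *v z))"
proof -
  have "exp_average (ad br y) (ad br z) = integral {0..1} (\<lambda>t. ad br (Ad y (- t) *v z))"
    unfolding exp_average_def Ad_def[symmetric] Ad_conj ..
  also have "\<dots> = ad br (integral {0..1} (\<lambda>t. Ad y (- t) *v z))"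
    using integral_linear[OF _ bounded_linear_ad, of "\<lambda>t. Ad y (- t) *v z" "{0..1}"]
    by (simp add: o_def integrable_continuous_interval continuous_intros)
  finally show ?thesis .
qed

end

section \<open>Gradients of invariant functions\<close>

text \<open>\<open>D\<close> is the differential and \<open>H\<close> the Hessian. Induction on the
  construction of the polynomial provides both, and the product rule visibly preserves complex
  homogeneity of \<open>D\<close> and symmetry of \<open>H\<close>.\<close>

lemma poly_fun_derivatives:
  assumes "poly_fun p"
  shows "\<exists>D H. (\<forall>x. (p has_derivative D x) (at x)) \<and> (\<forall>x c z. D x (c *s z) = c * D x z) \<and>
    (\<forall>x z. ((\<lambda>x. D x z) has_derivative H x z) (at x)) \<and> (\<forall>x z w. H x z w = H x w z)"
  using assms
proof induction
  case (const c)
  show ?case by (intro exI[of _ "\<lambda>x z. 0"] exI[of _ "\<lambda>x z w. 0"]) auto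
next
  case (coord i)
  show ?case
    by (intro exI[of _ "\<lambda>x z. z $ i"] exI[of _ "\<lambda>x z w. 0"])
      (auto intro: bounded_linear_imp_has_derivative bounded_linear_vec_nth)
next
  case (add p q)
  from add.IH(1) obtain D H where
    D: "\<forall>x. (p has_derivative D x) (at x)" "\<forall>x c z. D x (c *s z) = c * D x z"
      "\<forall>x z. ((\<lambda>x. D x z) has_derivative H x z) (at x)" "\<forall>x z w. H x z w = H x w z"
    by (elim exE conjE) (rule that)
  from add.IH(2) obtain D' H' where
    D': "\<forall>x. (q has_derivative D' x) (at x)" "\<forall>x c z. D' x (c *s z) = c * D' x z"
      "\<forall>x z. ((\<lambda>x. D' x z) has_derivative H' x z) (at x)" "\<forall>x z w. H' x z w = H' x w z"
    by (elim exE conjE) (rule that)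
  show ?case
    by (rule exI[of _ "\<lambda>x z. D x z + D' x z"], rule exI[of _ "\<lambda>x z w. H x z w + H' x z w"])
      (use D D' in \<open>auto intro!: has_derivative_add simp: distrib_left\<close>)
next
  case (mult p q)
  from mult.IH(1) obtain D H where
    D: "\<forall>x. (p has_derivative D x) (at x)" "\<forall>x c z. D x (c *s z) = c * D x z"
      "\<forall>x z. ((\<lambda>x. D x z) has_derivative H x z) (at x)" "\<forall>x z w. H x z w = H x w z"
    by (elim exE conjE) (rule that)
  from mult.IH(2) obtain D' H' where
    D': "\<forall>x. (q has_derivative D' x) (at x)" "\<forall>x c z. D' x (c *s z) = c * D' x z"
      "\<forall>x z. ((\<lambda>x. D' x z) has_derivative H' x z) (at x)" "\<forall>x z w. H' x z w = H' x w z"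
    by (elim exE conjE) (rule that)
  have 1: "((\<lambda>x. p x * q x) has_derivative (\<lambda>z. p x * D' x z + D x z * q x)) (at x)" for x
    by (intro has_derivative_mult D[rule_format] D'[rule_format])
  have 2: "((\<lambda>x. p x * D' x z + D x z * q x) has_derivative
      (\<lambda>w. (p x * H' x z w + D x w * D' x z) + (D x z * D' x w + H x z w * q x))) (at x)" for x z
    by (intro has_derivative_add has_derivative_mult D[rule_format] D'[rule_format])
  show ?case
    by (rule exI[of _ "\<lambda>x z. p x * D' x z + D x z * q x"],
        rule exI[of _ "\<lambda>x z w. (p x * H' x z w + D x w * D' x z) + (D x z * D' x w + H x z w * q x)"])
      (use 1 2 D D' in \<open>auto simp: algebra_simps\<close>)
qed

lemma has_vector_derivative_along_curve:
  assumes "(f has_derivative f') (at (\<gamma> t))" "(\<gamma> has_vector_derivative v) (at t)"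
  shows "((\<lambda>s. f (\<gamma> s)) has_vector_derivative f' v) (at t)"
proof -
  interpret f': bounded_linear f' using assms(1) by (rule has_derivative_bounded_linear)
  have "((\<lambda>s. f (\<gamma> s)) has_derivative (\<lambda>s. f' (s *\<^sub>R v))) (at t)"
    using diff_chain_at[OF assms(2)[unfolded has_vector_derivative_def] assms(1)] by (simp add: o_def)
  then show ?thesis by (simp add: has_vector_derivative_def f'.scaleR)
qed

lemma linear_functional_expansion:
  fixes \<phi> :: "complex ^ 'n::finite \<Rightarrow> complex"
  assumes "linear \<phi>" "\<And>c z. \<phi> (c *s z) = c * \<phi> z"
  shows "\<phi> z = (\<Sum>k\<in>UNIV. z $ k * \<phi> (axis k 1))"
proof -
  have "\<phi> z = \<phi> (\<Sum>k\<in>UNIV. z $ k *s axis k 1)" by (simp add: basis_expansion)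
  also have "\<dots> = (\<Sum>k\<in>UNIV. z $ k * \<phi> (axis k 1))"
    by (simp add: linear_sum[OF assms(1)] assms(2))
  finally show ?thesis .
qed

section \<open>Representing functionals and gradients through a nondegenerate Killing form\<close>

locale killing_nondegenerate = lie_alg +
  assumes nondegenerate: "(\<And>z. killing br x z = 0) \<Longrightarrow> x = 0"
begin

lemma killing_eqI: "(\<And>z. killing br x z = killing br y z) \<Longrightarrow> x = y"
  using nondegenerate[of "x - y"] by (simp add: killing.diff_left)

lemma ad_eq_iff: "ad br x = ad br y \<longleftrightarrow> x = y"
proof
  assume "ad br x = ad br y"
  then have "killing br x z = killing br y z" for z by (simp add: killing_def)
  then show "x = y" by (rule killing_eqI)
qed simp

text \<open>In coordinates the Killing form is an injective, hence invertible, linear map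
  \<open>L\<close>. Its inverse \<open>T\<close> is the same for all functionals, so a gradient can
  be differentiated through its coordinates.\<close>

lemma killing_dual_representation:
  "\<exists>T. bounded_linear T \<and>
    (\<forall>\<phi>. linear \<phi> \<longrightarrow> (\<forall>c z. \<phi> (c *s z) = c * \<phi> z) \<longrightarrow>
      killing_dual br \<phi> = T (\<chi> k. \<phi> (axis k 1)) \<and> (\<forall>z. killing br (T (\<chi> k. \<phi> (axis k 1))) z = \<phi> z))"
proof -
  define L where "L v = (\<chi> k. killing br v (axis k 1))" for v
  have exp: "killing br v z = (\<Sum>k\<in>UNIV. z $ k * L v $ k)" for v z
    using linear_functional_expansion[of "killing br v" z]
    by (simp add: L_def killing_smult_right bounded_linear.linear[OF killing.bounded_linear_right])
  have linL: "linear L"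
    by (intro linearI) (simp_all add: L_def vec_eq_iff killing.add_left killing.scaleR_left)
  moreover have "inj L"
    unfolding linear_injective_0[OF linL] by (auto intro: nondegenerate simp: exp)
  ultimately obtain T where T: "linear T" "\<And>x. L (T x) = x"
    using linear_injective_isomorphism by blast
  have K: "killing br (T (\<chi> k. \<phi> (axis k 1))) z = \<phi> z"
    if "linear \<phi>" "\<forall>c z. \<phi> (c *s z) = c * \<phi> z" for \<phi> z
    using linear_functional_expansion[of \<phi> z] that by (simp add: exp T(2))
  moreover have "killing_dual br \<phi> = T (\<chi> k. \<phi> (axis k 1))"
    if "linear \<phi>" "\<forall>c z. \<phi> (c *s z) = c * \<phi> z" for \<phi>
    unfolding killing_dual_def using K[OF that] by (intro the_equality killing_eqI) auto
  ultimately show ?thesis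
    using T(1) by (intro exI[of _ T]) (auto simp: linear_conv_bounded_linear)
qed

end

text \<open>\<open>D i x\<close> is the differential and \<open>H i x\<close> the Hessian of
  \<open>f i\<close>. Invariance is stated along one-parameter subgroups, the form in which it can
  be differentiated.\<close>

locale invariant_functions = killing_nondegenerate br for br :: "'n::finite bracket" +
  fixes f :: "'r::finite \<Rightarrow> complex ^ 'n \<Rightarrow> complex"
    and D :: "'r \<Rightarrow> complex ^ 'n \<Rightarrow> complex ^ 'n \<Rightarrow> complex"
    and H :: "'r \<Rightarrow> complex ^ 'n \<Rightarrow> complex ^ 'n \<Rightarrow> complex ^ 'n \<Rightarrow> complex"
  assumes f_deriv: "(f i has_derivative D i x) (at x)"
    and D_smult: "D i x (c *s z) = c * D i x z"
    and D_deriv: "((\<lambda>x. D i x z) has_derivative H i x z) (at x)"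
    and H_sym: "H i x z w = H i x w z"
    and f_invariant: "f i (Ad y t *v x) = f i x"
begin

definition grad :: "'r \<Rightarrow> complex ^ 'n \<Rightarrow> complex ^ 'n" where
  "grad i x = killing_dual br (frechet_derivative (f i) (at x))"

lemma frechet_derivative_f: "frechet_derivative (f i) (at x) = D i x"
  using frechet_derivative_at[OF f_deriv] by simp

lemma D_linear: "linear (D i x)"
  using f_deriv has_derivative_linear by blast

lemma H_linear_right: "linear (H i x z)"
  using D_deriv has_derivative_linear by blast

lemma H_linear_left: "linear (\<lambda>z. H i x z w)"
proof -
  have "(\<lambda>z. H i x z w) = H i x w" by (rule ext) (rule H_sym)
  then show ?thesis using H_linear_right by simp
qed

text \<open>Differentiating the homogeneity of \<open>D\<close> in the base point gives complex
  homogeneity in this slot, as is required to represent the Hessian by a vector.\<close>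

lemma H_smult_left: "H i x (c *s z) w = c * H i x z w"
proof -
  have "((\<lambda>x. D i x (c *s z)) has_derivative (\<lambda>w. c * H i x z w)) (at x)"
    unfolding D_smult by (intro has_derivative_mult_right D_deriv)
  from has_derivative_unique[OF this D_deriv] show ?thesis by metis
qed

lemma killing_grad: "killing br (grad i x) z = D i x z"
  using killing_dual_representation D_linear D_smult
  unfolding grad_def frechet_derivative_f by metis

lemma grad_differentiable:
  "\<exists>V. (grad i has_derivative V) (at x) \<and> (\<forall>w z. killing br (V w) z = H i x z w)"
proof -
  obtain T where T: "bounded_linear T"
    "\<And>\<phi>. linear \<phi> \<Longrightarrow> (\<And>c z. \<phi> (c *s z) = c * \<phi> z) \<Longrightarrow>
      killing_dual br \<phi> = T (\<chi> k. \<phi> (axis k 1)) \<and> (\<forall>z. killing br (T (\<chi> k. \<phi> (axis k 1))) z = \<phi> z)"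
    using killing_dual_representation by blast
  have "((\<lambda>x. \<chi> k. D i x (axis k 1)) has_derivative (\<lambda>w. \<chi> k. H i x (axis k 1) w)) (at x)"
    unfolding has_derivative_componentwise_within[of "\<lambda>x. \<chi> k. D i x (axis k 1)"]
  proof
    fix b :: "complex ^ 'n" assume "b \<in> Basis"
    then obtain k u where b: "b = axis k u" by (auto simp: Basis_vec_def)
    show "((\<lambda>x. (\<chi> k. D i x (axis k 1)) \<bullet> b) has_derivative (\<lambda>w. (\<chi> k. H i x (axis k 1) w) \<bullet> b)) (at x)"
      unfolding b inner_axis vec_lambda_beta by (intro has_derivative_inner_left D_deriv)
  qed
  from bounded_linear.has_derivative[OF T(1) this]
  have "(grad i has_derivative (\<lambda>w. T (\<chi> k. H i x (axis k 1) w))) (at x)"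
    using T(2)[OF D_linear D_smult] by (simp add: grad_def[abs_def] frechet_derivative_f)
  then show ?thesis
    using T(2)[OF H_linear_left H_smult_left] by blast
qed

text \<open>The Hessian as an endomorphism; by \<open>killing_dgrad\<close> and \<open>H_sym\<close>
  it is self-adjoint for the Killing form.\<close>

definition dgrad :: "'r \<Rightarrow> complex ^ 'n \<Rightarrow> complex ^ 'n \<Rightarrow> complex ^ 'n" where
  "dgrad i x = frechet_derivative (grad i) (at x)"

lemma grad_deriv: "(grad i has_derivative dgrad i x) (at x)"
  using grad_differentiable unfolding dgrad_def
  by (metis differentiableI frechet_derivative_works)

lemma killing_dgrad: "killing br (dgrad i x w) z = H i x z w"
  using grad_differentiable has_derivative_unique[OF grad_deriv] by metis

lemma D_Ad: "D i (Ad y t *v x) (Ad y t *v z) = D i x z"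
proof -
  have "((\<lambda>x. f i (Ad y t *v x)) has_derivative (\<lambda>z. D i (Ad y t *v x) (Ad y t *v z))) (at x)"
    using diff_chain_at[OF bounded_linear_imp_has_derivative[OF mv.bounded_linear_right] f_deriv]
    by (simp add: o_def)
  then have "(f i has_derivative (\<lambda>z. D i (Ad y t *v x) (Ad y t *v z))) (at x)"
    unfolding f_invariant .
  from has_derivative_unique[OF this f_deriv] show ?thesis by metis
qed

lemma grad_Ad: "grad i (Ad y t *v x) = Ad y t *v grad i x"
proof (rule killing_eqI)
  fix z
  \<comment> \<open>Writing \<open>z\<close> as \<open>Ad y t\<close> applied to
    \<open>Ad y (- t) *v z\<close> makes the invariance of the differential applicable.\<close>
  have "killing br (grad i (Ad y t *v x)) z = D i (Ad y t *v x) (Ad y t *v (Ad y (- t) *v z))"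
    by (simp add: killing_grad)
  also have "\<dots> = killing br (grad i x) (Ad y (- t) *v z)"
    unfolding D_Ad killing_grad ..
  finally show "killing br (grad i (Ad y t *v x)) z = killing br (Ad y t *v grad i x) z"
    by (simp add: killing_Ad_left)
qed

text \<open>\<open>f i\<close> is constant on orbits, so its differential at \<open>x\<close> kills
  every \<open>br y x\<close>. Invariance of the form moves this to the bracket of the gradient with
  \<open>x\<close>.\<close>

lemma br_grad_self: "br (grad i x) x = 0"
proof (rule nondegenerate)
  fix y
  have "((\<lambda>t. f i (Ad y t *v x)) has_vector_derivative D i x (br y x)) (at 0)"
    using has_vector_derivative_along_curve[OF f_deriv has_vector_derivative_Ad[of y x 0]] by simp
  then have "D i x (br y x) = 0"
    unfolding f_invariant using vector_derivative_unique_at has_vector_derivative_const by blast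
  then show "killing br (br (grad i x) x) y = 0"
    by (simp add: killing_invariant br_skew[of x] killing.minus_right killing_grad)
qed

text \<open>Infinitesimal equivariance: both sides are the velocity at t = 0 of the gradient along
  the orbit curve through \<open>x\<close>.\<close>

lemma dgrad_br: "dgrad i x (br y x) = br y (grad i x)"
proof -
  have "((\<lambda>t. grad i (Ad y t *v x)) has_vector_derivative dgrad i x (br y x)) (at 0)"
    using has_vector_derivative_along_curve[OF grad_deriv has_vector_derivative_Ad[of y x 0]] by simp
  moreover have "((\<lambda>t. grad i (Ad y t *v x)) has_vector_derivative br y (grad i x)) (at 0)"
    using has_vector_derivative_Ad[of y "grad i x" 0] by (simp add: grad_Ad)
  ultimately show ?thesis by (rule vector_derivative_unique_at)
qed

text \<open>Infinitesimal equivariance in the direction y = \<open>grad j x\<close>: this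
  \<open>y\<close> centralizes \<open>x\<close>, so the Hessian is applied to zero.\<close>

lemma br_grad_grad: "br (grad j x) (grad i x) = 0"
  using dgrad_br[of i x "grad j x"] has_derivative_linear[OF grad_deriv[of i x]]
  by (simp add: br_grad_self linear_0)

text \<open>Equivariance of the gradient is differentiated in the base point; since
  \<open>Ad y t\<close> fixes \<open>x\<close>, both sides involve the Hessian at the same
  point.\<close>

lemma dgrad_Ad:
  assumes "br y x = 0"
  shows "dgrad i x (Ad y t *v w) = Ad y t *v dgrad i x w"
proof -
  have "((\<lambda>x. grad i (Ad y t *v x)) has_derivative (\<lambda>w. dgrad i (Ad y t *v x) (Ad y t *v w))) (at x)"
    using diff_chain_at[OF bounded_linear_imp_has_derivative[OF mv.bounded_linear_right] grad_deriv]
    by (simp add: o_def)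
  moreover have "((\<lambda>x. grad i (Ad y t *v x)) has_derivative (\<lambda>w. Ad y t *v dgrad i x w)) (at x)"
    unfolding grad_Ad by (intro bounded_linear.has_derivative[OF mv.bounded_linear_right] grad_deriv)
  ultimately show ?thesis
    using has_derivative_unique by (metis Ad_fixes[OF assms])
qed

end

section \<open>The pullback of the symplectic form\<close>

lemma bounded_bilinear_smult_vec:
  "bounded_bilinear ((*s) :: complex \<Rightarrow> complex ^ 'n \<Rightarrow> complex ^ ('n::finite))"
  unfolding bilinear_conv_bounded_bilinear[symmetric] bilinear_def
  by (intro conjI allI linearI) (simp_all add: vec_eq_iff distrib_left distrib_right)

interpretation smult_vec: bounded_bilinear "(*s) :: complex \<Rightarrow> complex ^ 'n \<Rightarrow> complex ^ ('n::finite)"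
  by (rule bounded_bilinear_smult_vec)

lemma integral_reflect_unit_interval:
  fixes g :: "real \<Rightarrow> 'a::euclidean_space"
  assumes "continuous_on UNIV g"
  shows "integral {0..1} (\<lambda>t. g (1 - t)) = integral {0..1} g"
proof -
  have "(g has_integral integral {0..1} g) (cbox 0 1)"
    using assms by (auto intro!: integrable_integral integrable_continuous_interval intro: continuous_on_subset)
  from has_integral_affinity[OF this, of "-1" 1]
  have "((\<lambda>t. g (1 - t)) has_integral integral {0..1} g) {0..1}"
    by simp
  then show ?thesis by (rule integral_unique)
qed

text \<open>A derivative within \<open>M\<close> is determined only on velocities of curves in
  \<open>M\<close>. Composing such a curve with \<open>F\<close> computes the same velocity from the
  ambient derivative \<open>F'\<close> and from the differential within \<open>M\<close>.\<close>

lemma differential_tangent: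
  assumes "(F has_derivative F') (at p)" "p \<in> M" "u \<in> tangent_space M p"
  shows "differential M F p u = F' u"
    and "F ` M \<subseteq> N \<Longrightarrow> F' u \<in> tangent_space N (F p)"
proof -
  obtain \<gamma> where \<gamma>: "\<gamma> 0 = p" "\<forall>\<^sub>F s in nhds 0. \<gamma> s \<in> M" "(\<gamma> has_vector_derivative u) (at (0::real))"
    using assms(3) unfolding tangent_space_def by blast
  have F': "((\<lambda>s. F (\<gamma> s)) has_vector_derivative F' u) (at 0)"
    using has_vector_derivative_along_curve[OF _ \<gamma>(3)] assms(1) \<gamma>(1) by blast
  show "F' u \<in> tangent_space N (F p)" if "F ` M \<subseteq> N"
  proof -
    have "\<forall>\<^sub>F s in nhds 0. F (\<gamma> s) \<in> N"
      using \<gamma>(2) by (rule eventually_mono) (use that in blast)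
    then show ?thesis
      unfolding tangent_space_def
      by (intro CollectI exI[of _ "\<lambda>s. F (\<gamma> s)"] conjI) (simp_all only: F' \<gamma>(1))
  qed
  have "F differentiable (at p within M)"
    using assms(1) differentiableI has_derivative_at_withinI by blast
  then have d: "(F has_derivative differential M F p) (at p within M)"
    unfolding differential_def frechet_derivative_works .
  interpret d: bounded_linear "differential M F p" using d by (rule has_derivative_bounded_linear)
  \<comment> \<open>The curve lies in \<open>M\<close> only for small times, so the chain rule is
    applied on a neighbourhood \<open>U\<close> of 0.\<close>
  obtain U where U: "open U" "0 \<in> U" "\<And>s. s \<in> U \<Longrightarrow> \<gamma> s \<in> M"
    using \<gamma>(2) unfolding eventually_nhds by blast
  have "(\<gamma> has_derivative (\<lambda>s. s *\<^sub>R u)) (at 0 within U)"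
    using \<gamma>(3) unfolding has_vector_derivative_def by (rule has_derivative_at_withinI)
  moreover have "(F has_derivative differential M F p) (at (\<gamma> 0) within \<gamma> ` U)"
    using d U(3) \<gamma>(1) by (auto intro: has_derivative_subset)
  ultimately have "((\<lambda>s. F (\<gamma> s)) has_derivative (\<lambda>s. differential M F p (s *\<^sub>R u))) (at 0 within U)"
    by (rule has_derivative_in_compose)
  then have "((\<lambda>s. F (\<gamma> s)) has_vector_derivative differential M F p u) (at 0)"
    using U at_within_open[of 0 U] by (simp add: has_vector_derivative_def d.scaleR)
  with F' show "differential M F p u = F' u"
    using vector_derivative_unique_at by blast
qed

section \<open>Left trivialization, the derivative of \<Phi> and the pullback\<close>

context killing_nondegenerate
begin

text \<open>A left inverse of \<open>g\<close> together with injectivity of \<open>ad\<close> makes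
  the definite description well defined.\<close>

lemma left_trivialize_d_left_translation:
  assumes "g' ** g = mat 1"
  shows "left_trivialize br g (d_left_translation br g y) = y"
  unfolding left_trivialize_def d_left_translation_def
proof (rule the_equality)
  fix z assume "g ** ad br z = g ** ad br y"
  then have "(g' ** g) ** ad br z = (g' ** g) ** ad br y"
    by (metis matrix_mul_assoc)
  then show "z = y" by (simp add: assms ad_eq_iff)
qed simp

end

context invariant_functions
begin

definition exponent :: "(complex ^ 'r) \<times> (complex ^ 'n) \<Rightarrow> complex ^ 'n" where
  "exponent p = (\<Sum>i\<in>UNIV. fst p $ i *s grad i (snd p))"

definition exponent_deriv :: "(complex ^ 'r) \<times> (complex ^ 'n) \<Rightarrow> (complex ^ 'r) \<times> (complex ^ 'n) \<Rightarrow> complex ^ 'n" where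
  "exponent_deriv p u = (\<Sum>i\<in>UNIV. fst p $ i *s dgrad i (snd p) (snd u) + fst u $ i *s grad i (snd p))"

text \<open>The left logarithmic derivative of exp Y in direction \<open>u\<close>, where Y is
  \<open>exponent p\<close>, given by Duhamel's integral.\<close>

definition log_deriv :: "(complex ^ 'r) \<times> (complex ^ 'n) \<Rightarrow> (complex ^ 'r) \<times> (complex ^ 'n) \<Rightarrow> complex ^ 'n" where
  "log_deriv p u = integral {0..1} (\<lambda>t. Ad (exponent p) (- t) *v exponent_deriv p u)"

definition Phi_deriv :: "(complex ^ 'r) \<times> (complex ^ 'n) \<Rightarrow> (complex ^ 'r) \<times> (complex ^ 'n) \<Rightarrow> (complex ^ 'n ^ 'n) \<times> (complex ^ 'n)" where
  "Phi_deriv p u = (d_left_translation br (lie_exp br (exponent p)) (log_deriv p u), snd u)"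

lemma Phi_map_eq: "Phi_map br f = (\<lambda>p. (lie_exp br (exponent p), snd p))"
  by (auto simp: Phi_map_def exponent_def grad_def)

lemma exponent_has_derivative: "(exponent has_derivative exponent_deriv p) (at p)"
proof -
  have 1: "((\<lambda>p :: (complex ^ 'r) \<times> (complex ^ 'n). fst p $ i) has_derivative (\<lambda>u. fst u $ i)) (at p)" for i
    by (intro bounded_linear_imp_has_derivative bounded_linear_compose[OF bounded_linear_vec_nth bounded_linear_fst])
  have 2: "((\<lambda>p :: (complex ^ 'r) \<times> (complex ^ 'n). grad i (snd p)) has_derivative (\<lambda>u. dgrad i (snd p) (snd u))) (at p)" for i
    using diff_chain_at[OF bounded_linear_imp_has_derivative[OF bounded_linear_snd] grad_deriv]
    by (simp add: o_def)
  show ?thesis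
    unfolding exponent_def[abs_def] exponent_deriv_def[abs_def]
    by (intro has_derivative_sum smult_vec.FDERIV 1 2)
qed

lemma lie_exp_exponent_has_derivative:
  "((\<lambda>p. lie_exp br (exponent p)) has_derivative
     (\<lambda>u. d_left_translation br (lie_exp br (exponent p)) (log_deriv p u))) (at p)"
proof -
  have "((\<lambda>p. ad br (exponent p)) has_derivative (\<lambda>u. ad br (exponent_deriv p u))) (at p)"
    by (intro bounded_linear.has_derivative[OF bounded_linear_ad] exponent_has_derivative)
  from diff_chain_at[OF this has_derivative_matrix_exp] show ?thesis
    by (simp add: o_def lie_exp_def d_left_translation_def log_deriv_def exp_average_ad)
qed

lemma Phi_map_has_derivative: "(Phi_map br f has_derivative Phi_deriv p) (at p)"
  unfolding Phi_map_eq Phi_deriv_def[abs_def]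
  by (intro has_derivative_Pair lie_exp_exponent_has_derivative has_derivative_snd has_derivative_ident)

lemma br_exponent_self: "br (exponent p) (snd p) = 0"
  by (simp add: exponent_def br.sum_left br_smult_left br_grad_self)

lemma br_exponent_grad: "br (exponent p) (grad i (snd p)) = 0"
  by (simp add: exponent_def br.sum_left br_smult_left br_grad_grad)

lemma lie_exp_exponent_fixes: "lie_exp br (exponent p) *v snd p = snd p"
  unfolding Ad_1[symmetric] by (intro Ad_fixes br_exponent_self)

lemma Phi_map_in_universal_centralizer:
  "snd p \<in> S \<Longrightarrow> Phi_map br f p \<in> universal_centralizer br S"
  using Ad_in_adjoint_group[of "exponent p" 1] lie_exp_exponent_fixes[of p]
  by (simp add: Phi_map_eq universal_centralizer_def group_stabilizer_def Ad_1)

text \<open>The map sending \<open>p\<close> to exp Y applied to \<open>snd p\<close> coincides with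
  \<open>snd\<close>. Equating the two derivatives and applying exp (-Y) gives the bracket.\<close>

lemma br_log_deriv: "br (log_deriv p u) (snd p) = Ad (exponent p) (- 1) *v snd u - snd u"
proof -
  let ?g = "lie_exp br (exponent p)"
  have "((\<lambda>p. lie_exp br (exponent p) *v snd p) has_derivative
      (\<lambda>u. ?g *v snd u + d_left_translation br ?g (log_deriv p u) *v snd p)) (at p)"
    by (intro mv.FDERIV lie_exp_exponent_has_derivative has_derivative_snd has_derivative_ident)
  then have a: "(snd has_derivative (\<lambda>u. ?g *v snd u + d_left_translation br ?g (log_deriv p u) *v snd p)) (at p)"
    unfolding lie_exp_exponent_fixes .
  have "(snd has_derivative snd) (at p)"
    by (intro bounded_linear_imp_has_derivative bounded_linear_snd)
  from fun_cong[OF has_derivative_unique[OF a this], of u]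
  have "?g *v snd u + d_left_translation br ?g (log_deriv p u) *v snd p = snd u" .
  then have "?g *v (snd u + br (log_deriv p u) (snd p)) = snd u"
    by (simp add: d_left_translation_def mv.add_right flip: matrix_vector_mul_assoc)
  from arg_cong[OF this, of "\<lambda>v. Ad (exponent p) (- 1) *v v"]
  show ?thesis by (simp add: algebra_simps flip: Ad_1)
qed

text \<open>The Hessian commutes with \<open>Ad\<close>; combined with its symmetry, this makes the integrand constant.\<close>

lemma exponent_deriv_pairing:
  "killing br (Ad (exponent p) (- t) *v exponent_deriv p u) (snd w)
     - killing br (snd u) (Ad (exponent p) t *v exponent_deriv p w) =
   (\<Sum>i\<in>UNIV. fst u $ i * D i (snd p) (snd w) - fst w $ i * D i (snd p) (snd u))"
proof -
  \<comment> \<open>\<open>Ad\<close> fixes the gradients, which commute with the exponent, and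
    passes through the Hessian endomorphism because the exponent centralizes the base point.\<close>
  have split: "Ad (exponent p) s *v exponent_deriv p v =
      (\<Sum>i\<in>UNIV. fst p $ i *s dgrad i (snd p) (Ad (exponent p) s *v snd v) + fst v $ i *s grad i (snd p))" for s v
    unfolding exponent_deriv_def mv.sum_right mv.add_right
    by (simp add: vector_scalar_commute Ad_fixes[OF br_exponent_grad] dgrad_Ad[OF br_exponent_self])
  have "H i (snd p) (snd w) (Ad (exponent p) (- t) *v snd u) = H i (snd p) (snd u) (Ad (exponent p) t *v snd w)" for i
  proof -
    have "H i (snd p) (snd u) (Ad (exponent p) t *v snd w) = killing br (Ad (exponent p) t *v dgrad i (snd p) (snd w)) (snd u)"
      by (simp add: dgrad_Ad[OF br_exponent_self, symmetric] killing_dgrad)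
    also have "\<dots> = H i (snd p) (Ad (exponent p) (- t) *v snd u) (snd w)"
      by (simp add: killing_Ad_left killing_dgrad)
    finally show ?thesis by (simp only: H_sym[of i _ "snd w"])
  qed
  then show ?thesis
    unfolding split killing_sym[of "snd u"]
    by (simp add: killing.sum_left killing.add_left killing_smult_left killing_grad killing_dgrad
        sum.distrib flip: sum_subtractf)
qed

lemma Omega_form_Phi_deriv:
  "Omega_form br (Phi_map br f p) (Phi_deriv p u) (Phi_deriv p w) =
   (\<Sum>i\<in>UNIV. fst u $ i * D i (snd p) (snd w) - fst w $ i * D i (snd p) (snd u))"
proof -
  let ?A = "Ad (exponent p)" and ?y = "log_deriv p" and ?x = "snd p" and ?Y = "exponent_deriv p"
  have int: "(\<lambda>t. ?A (- t) *v ?Y v) integrable_on {0..1}" "(\<lambda>t. ?A t *v ?Y v) integrable_on {0..1}" for v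
    by (intro integrable_continuous_interval continuous_intros)+
  have inv: "?A (- 1) ** lie_exp br (exponent p) = mat 1"
    using Ad_minus_left[of "exponent p" 1] by (simp add: Ad_1)
  have "Omega_form br (Phi_map br f p) (Phi_deriv p u) (Phi_deriv p w) =
      killing br (?y u) (snd w) - killing br (?y w) (snd u) + killing br ?x (br (?y u) (?y w))"
    by (simp add: Omega_form_def Let_def Phi_map_eq Phi_deriv_def left_trivialize_d_left_translation[OF inv])
  \<comment> \<open>Invariance of the form exposes the bracket of \<open>?y u\<close> with the base
    point, which \<open>br_log_deriv\<close> evaluates.\<close>
  also have "killing br ?x (br (?y u) (?y w)) = killing br (snd u) (?y w) - killing br (snd u) (?A 1 *v ?y w)"
  proof -
    have "killing br ?x (br (?y u) (?y w)) = - killing br (br (?y u) ?x) (?y w)"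
      by (simp add: br_skew[of ?x] killing.minus_left flip: killing_invariant)
    then show ?thesis
      by (simp add: br_log_deriv killing.diff_left killing_Ad_left)
  qed
  \<comment> \<open>The factor at time 1 turns -t into 1 - t, and reflecting the unit interval gives
    t.\<close>
  also have "?A 1 *v ?y w = integral {0..1} (\<lambda>t. ?A t *v ?Y w)"
  proof -
    have "?A 1 *v ?y w = integral {0..1} (\<lambda>t. ?A 1 *v (?A (- t) *v ?Y w))"
      unfolding log_deriv_def
      using integral_linear[OF int(1) mv.bounded_linear_right[of "?A 1"], of w] by (simp add: o_def)
    also have "\<dots> = integral {0..1} (\<lambda>t. ?A (1 - t) *v ?Y w)"
      by (simp add: Ad_add)
    also have "\<dots> = integral {0..1} (\<lambda>t. ?A t *v ?Y w)"
      by (intro integral_reflect_unit_interval[of "\<lambda>t. ?A t *v ?Y w"] continuous_intros)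
    finally show ?thesis .
  qed
  \<comment> \<open>The two pairings of \<open>?y w\<close> with \<open>snd u\<close> cancel by
    symmetry; the two remaining ones are put under one integral.\<close>
  also have "killing br (?y u) (snd w) - killing br (?y w) (snd u) +
      (killing br (snd u) (?y w) - killing br (snd u) (integral {0..1} (\<lambda>t. ?A t *v ?Y w))) =
    integral {0..1} (\<lambda>t. killing br (?A (- t) *v ?Y u) (snd w) - killing br (snd u) (?A t *v ?Y w))"
    using integral_linear[OF int(1)[of u] killing.bounded_linear_left[of "snd w"]]
      integral_linear[OF int(2)[of w] killing.bounded_linear_right[of "snd u"]]
      integrable_linear[OF int(1)[of u] killing.bounded_linear_left[of "snd w"]]
      integrable_linear[OF int(2)[of w] killing.bounded_linear_right[of "snd u"]]
    by (simp add: o_def log_deriv_def killing_sym[of _ "snd u"] integral_diff)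
  \<comment> \<open>The integrand does not depend on t and the interval has length one.\<close>
  also have "\<dots> = (\<Sum>i\<in>UNIV. fst u $ i * D i ?x (snd w) - fst w $ i * D i ?x (snd u))"
    unfolding exponent_deriv_pairing by simp
  finally show ?thesis .
qed

lemma nu_form_tangent:
  assumes "p \<in> UNIV \<times> S" "u \<in> tangent_space (UNIV \<times> S) p" "w \<in> tangent_space (UNIV \<times> S) p"
  shows "nu_form f S p u w = (\<Sum>i\<in>UNIV. fst u $ i * D i (snd p) (snd w) - fst w $ i * D i (snd p) (snd u))"
proof -
  have 1: "((\<lambda>(l, x). l $ i) has_derivative (\<lambda>u. fst u $ i)) (at p)" for i :: 'r
    unfolding case_prod_beta
    by (intro bounded_linear_imp_has_derivative bounded_linear_compose[OF bounded_linear_vec_nth bounded_linear_fst])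
  have 2: "((\<lambda>(l, x). f i x) has_derivative (\<lambda>u. D i (snd p) (snd u))) (at p)" for i
    unfolding case_prod_beta
    using diff_chain_at[OF bounded_linear_imp_has_derivative[OF bounded_linear_snd] f_deriv]
    by (simp add: o_def)
  show ?thesis
    unfolding nu_form_def wedge_def
      differential_tangent(1)[OF 1 assms(1,2)] differential_tangent(1)[OF 1 assms(1,3)]
      differential_tangent(1)[OF 2 assms(1,2)] differential_tangent(1)[OF 2 assms(1,3)] ..
qed

theorem Phi_map_pullback:
  "Phi_map br f ` (UNIV \<times> S) \<subseteq> universal_centralizer br S"
  "Phi_map br f differentiable_on (UNIV \<times> S)"
  "forms_agree_on (UNIV \<times> S)
     (pullback_form (UNIV \<times> S) (Phi_map br f) (omega_form br S)) (nu_form f S)"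
proof -
  show im: "Phi_map br f ` (UNIV \<times> S) \<subseteq> universal_centralizer br S"
    using Phi_map_in_universal_centralizer by fastforce
  show "Phi_map br f differentiable_on (UNIV \<times> S)"
    unfolding differentiable_on_def
    using Phi_map_has_derivative differentiableI has_derivative_at_withinI by blast
  show "forms_agree_on (UNIV \<times> S)
     (pullback_form (UNIV \<times> S) (Phi_map br f) (omega_form br S)) (nu_form f S)"
    unfolding forms_agree_on_def
  proof (intro ballI)
    fix p :: "(complex ^ 'r) \<times> (complex ^ 'n)" and u w
    assume p: "p \<in> UNIV \<times> S" and uw: "u \<in> tangent_space (UNIV \<times> S) p" "w \<in> tangent_space (UNIV \<times> S) p"
    note du = differential_tangent[OF Phi_map_has_derivative p uw(1)]
    note dw = differential_tangent[OF Phi_map_has_derivative p uw(2)]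
    show "pullback_form (UNIV \<times> S) (Phi_map br f) (omega_form br S) p u w = nu_form f S p u w"
      unfolding pullback_form_def du(1) dw(1) omega_form_def restrict_form_def
      \<comment> \<open>\<open>restrict_form\<close> is \<open>undefined\<close> elsewhere, so the
        image point must lie in the universal centralizer and the image vectors must be tangent to
        it.\<close>
      using du(2)[OF im] dw(2)[OF im] im p
      by (auto simp: Omega_form_Phi_deriv nu_form_tangent[OF p uw])
  qed
qed

end

section \<open>Nondegeneracy of the Killing form\<close>

text \<open>A basis of eigenvectors is extracted from the spanning set; grouping it by eigenvalue
  gives one finite set \<open>C\<close> that serves every vector.\<close>

lemma eigenvector_decomposition:
  fixes T :: "complex ^ 'n::finite \<Rightarrow> complex ^ 'n"
  assumes lin: "Vector_Spaces.linear (*s) (*s) T"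
    and span: "vec.span {y. \<exists>c. T y = c *s y} = UNIV"
  shows "\<exists>C. finite C \<and> (\<forall>w. \<exists>e. (\<forall>c\<in>C. T (e c) = c *s e c) \<and> w = (\<Sum>c\<in>C. e c))"
proof -
  let ?E = "{y. \<exists>c. T y = c *s y}"
  obtain B where B: "B \<subseteq> ?E" "vec.independent B" "?E \<subseteq> vec.span B"
    using vec.maximal_independent_subset[of ?E] by blast
  have fin: "finite B" using B(2) by (rule vec.finiteI_independent)
  have spanB: "vec.span B = UNIV"
    using vec.span_minimal[OF B(3) vec.subspace_span] span by auto
  have "\<forall>b\<in>B. \<exists>c. T b = c *s b" using B(1) by blast
  from bchoice[OF this] obtain ev where ev: "\<And>b. b \<in> B \<Longrightarrow> T b = ev b *s b" by blast
  have "\<exists>e. (\<forall>c\<in>ev ` B. T (e c) = c *s e c) \<and> w = (\<Sum>c\<in>ev ` B. e c)" for w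
  proof -
    have "w \<in> range (\<lambda>u. \<Sum>b\<in>B. u b *s b)"
      using spanB unfolding vec.span_finite[OF fin] by simp
    then obtain u where u: "w = (\<Sum>b\<in>B. u b *s b)" by blast
    define e where "e c = (\<Sum>b\<in>{b \<in> B. ev b = c}. u b *s b)" for c
    have "T (e c) = c *s e c" for c
      unfolding e_def vec.linear_sum[OF lin] vec.scale_sum_right
      by (intro sum.cong) (auto simp: vec.linear_scale[OF lin] ev mult.commute)
    moreover have "w = (\<Sum>c\<in>ev ` B. e c)"
      unfolding u e_def by (rule sum.image_gen[OF fin])
    ultimately show ?thesis by blast
  qed
  with fin show ?thesis by blast
qed

text \<open>Applying T - a to the sum kills the component of eigenvalue a and multiplies the others
  by the nonzero numbers c - a. Induction puts those in \<open>W\<close>, and subtraction then puts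
  the remaining component in \<open>W\<close>.\<close>

lemma eigenvector_components:
  fixes T :: "complex ^ 'n::finite \<Rightarrow> complex ^ 'n"
  assumes lin: "Vector_Spaces.linear (*s) (*s) T"
    and W: "vec.subspace W" "\<And>w. w \<in> W \<Longrightarrow> T w \<in> W"
    and "finite C" "\<And>c. c \<in> C \<Longrightarrow> T (e c) = c *s e c" "(\<Sum>c\<in>C. e c) \<in> W"
  shows "\<forall>c\<in>C. e c \<in> W"
  using assms(4-)
proof (induction C arbitrary: e rule: finite_induct)
  case (insert a C)
  let ?s = "\<Sum>c\<in>insert a C. e c"
  have "T ?s - a *s ?s = (\<Sum>c\<in>insert a C. (c - a) *s e c)"
    unfolding vec.linear_sum[OF lin] vec.scale_sum_right sum_subtractf[symmetric]
    by (intro sum.cong) (simp_all add: insert.prems(1) vec.scale_left_diff_distrib)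
  also have "\<dots> = (\<Sum>c\<in>C. (c - a) *s e c)"
    using insert.hyps by simp
  finally have "T ?s - a *s ?s = (\<Sum>c\<in>C. (c - a) *s e c)" .
  moreover have "T ?s - a *s ?s \<in> W"
    using insert.prems(2) W by (intro vec.subspace_diff vec.subspace_scale)
  ultimately have "(\<Sum>c\<in>C. (c - a) *s e c) \<in> W" by simp
  moreover have "T ((c - a) *s e c) = c *s ((c - a) *s e c)" if "c \<in> C" for c
    using that by (simp only: vec.linear_scale[OF lin] insert.prems(1) insertI2 vec.scale_scale mult.commute)
  ultimately have "\<forall>c\<in>C. (c - a) *s e c \<in> W"
    by (intro insert.IH)
  then have "inverse (c - a) *s ((c - a) *s e c) \<in> W" if "c \<in> C" for c
    using W(1) that by (blast intro: vec.subspace_scale)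
  moreover have "inverse (c - a) *s ((c - a) *s e c) = e c" if "c \<in> C" for c
  proof -
    have "c \<noteq> a" using that insert.hyps(2) by auto
    then have "inverse (c - a) * (c - a) = 1" by simp
    then show ?thesis by (simp only: vec.scale_scale vec.scale_one)
  qed
  ultimately have C: "\<forall>c\<in>C. e c \<in> W" by metis
  then have "(\<Sum>c\<in>C. e c) \<in> W" using W(1) by (blast intro: vec.subspace_sum)
  then have "?s - (\<Sum>c\<in>C. e c) \<in> W" using insert.prems(2) W(1) vec.subspace_diff by blast
  with C insert.hyps show ?case by simp
qed simp

text \<open>The components of an eigenvector lie in its own eigenspace, so if its eigenvalue were
  outside \<open>C\<close> they would all vanish.\<close>

lemma finite_eigenvalues:
  fixes T :: "complex ^ 'n::finite \<Rightarrow> complex ^ 'n"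
  assumes lin: "Vector_Spaces.linear (*s) (*s) T"
    and span: "vec.span {y. \<exists>c. T y = c *s y} = UNIV"
  shows "finite {c. \<exists>v. v \<noteq> 0 \<and> T v = c *s v}"
proof -
  obtain C where C: "finite C" "\<And>w. \<exists>e. (\<forall>c\<in>C. T (e c) = c *s e c) \<and> w = (\<Sum>c\<in>C. e c)"
    using eigenvector_decomposition[OF assms] by blast
  have "c \<in> C" if "v \<noteq> 0" "T v = c *s v" for v c
  proof (rule ccontr)
    assume "c \<notin> C"
    obtain e where e: "\<And>d. d \<in> C \<Longrightarrow> T (e d) = d *s e d" "v = (\<Sum>d\<in>C. e d)" using C(2) by blast
    have "\<forall>d\<in>C. e d \<in> {v. T v = c *s v}"
    proof (rule eigenvector_components[OF lin])
      show "vec.subspace {v. T v = c *s v}"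
        by (simp add: vec.subspace_def vec.linear_0[OF lin] vec.linear_add[OF lin]
            vec.linear_scale[OF lin] vec.scale_right_distrib mult.commute)
    qed (use C(1) e that in \<open>simp_all add: vec.linear_scale[OF lin]\<close>)
    with e(1) have "c *s e d = d *s e d" if "d \<in> C" for d using that by auto
    then have "e d = 0" if "d \<in> C" for d using that \<open>c \<notin> C\<close> vec.scale_cancel_right by metis
    with e(2) \<open>v \<noteq> 0\<close> show False by simp
  qed
  then have "{c. \<exists>v. v \<noteq> 0 \<and> T v = c *s v} \<subseteq> C" by blast
  then show ?thesis using C(1) by (rule finite_subset)
qed

section \<open>Highest weights for an \<ss>\<ll>2-triple\<close>

context lie_alg
begin

lemma subspace_eigenspace: "vec.subspace {v. br k v = c *s v}"
  by (simp add: vec.subspace_def br.zero_right br.add_right br_smult_right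
      vec.scale_right_distrib mult.commute)

text \<open>In an \<open>\<ss>\<ll>\<^sub>2\<close>-module without zero weight, lowering a highest weight vector of weight
  \<open>2 n\<close> exactly \<open>n\<close> times reaches weight zero, hence gives zero; raising it back shows that the
  highest weight vector was zero.\<close>

lemma sl2_positive_even_weight:
  assumes tri: "br E F = h" "br h E = 2 *s E" "br h F = (- 2) *s F"
    and R: "\<And>a r. r \<in> R \<Longrightarrow> br a r \<in> R"
    and no_zero: "\<And>v. v \<in> R \<Longrightarrow> br h v = 0 \<Longrightarrow> v = 0"
    and fin: "finite {c. \<exists>v. v \<noteq> 0 \<and> br h v = c *s v}"
    and v: "v \<in> R" "br h v = (2 * of_nat n) *s v" "n > 0"
  shows "v = 0"
proof (rule ccontr)
  assume "v \<noteq> 0"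
  \<comment> \<open>The given vector need not have highest weight. The positive even weights
    occurring in \<open>R\<close> are finitely many, and the largest of them supplies a highest
    weight vector \<open>u\<close>.\<close>
  define N where "N = {n::nat. n > 0 \<and> (\<exists>v\<in>R. v \<noteq> 0 \<and> br h v = (2 * of_nat n) *s v)}"
  have "(\<lambda>n. 2 * of_nat n) ` N \<subseteq> {c. \<exists>v. v \<noteq> 0 \<and> br h v = c *s v}"
    by (auto simp: N_def)
  then have "finite ((\<lambda>n. 2 * of_nat n :: complex) ` N)" using fin finite_subset by blast
  then have finN: "finite N" by (rule finite_imageD) (simp add: inj_on_def)
  have "n \<in> N" using v \<open>v \<noteq> 0\<close> by (auto simp: N_def)
  define m where "m = Max N"
  have "m \<in> N" using finN \<open>n \<in> N\<close> unfolding m_def by (intro Max_in) auto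
  then obtain u where u: "u \<in> R" "u \<noteq> 0" "br h u = (2 * of_nat m) *s u" "m > 0"
    by (auto simp: N_def)
  have "br h (br E u) = 2 *s br E u + (2 * of_nat m) *s br E u"
    by (simp only: jacobi[of h E] tri u(3) br_smult_left br_smult_right)
  also have "\<dots> = (2 * of_nat (Suc m)) *s br E u"
    unfolding vec.scale_left_distrib[symmetric]
    by (rule arg_cong[where f="\<lambda>c. c *s br E u"]) simp
  finally have hEu: "br h (br E u) = (2 * of_nat (Suc m)) *s br E u" .
  have Eu: "br E u = 0"
  proof (rule ccontr)
    assume "br E u \<noteq> 0"
    then have "Suc m \<in> N" unfolding N_def using hEu R[OF u(1), of E] by blast
    from Max_ge[OF finN this] show False by (simp add: m_def)
  qed
  define w where "w j = ((br F) ^^ j) u" for j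
  have w_Suc: "w (Suc j) = br F (w j)" for j by (simp add: w_def)
  have wR: "w j \<in> R" for j by (induction j) (use u(1) R in \<open>auto simp: w_def\<close>)
  have hw: "br h (w j) = (2 * of_nat m - 2 * of_nat j) *s w j" for j
  proof (induction j)
    case (Suc j)
    have "br h (w (Suc j)) = (- 2) *s w (Suc j) + (2 * of_nat m - 2 * of_nat j) *s w (Suc j)"
      by (simp only: w_Suc jacobi[of h F] tri Suc br_smult_left br_smult_right)
    also have "\<dots> = (2 * of_nat m - 2 * of_nat (Suc j)) *s w (Suc j)"
      unfolding vec.scale_left_distrib[symmetric]
      by (rule arg_cong[where f="\<lambda>c. c *s w (Suc j)"]) simp
    finally show ?case .
  qed (simp add: w_def u(3))
  \<comment> \<open>The standard formula for raising a lowered highest weight vector, here of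
    highest weight 2 m.\<close>
  have Ew: "br E (w (Suc j)) = (of_nat (Suc j) * (2 * of_nat m - of_nat j)) *s w j" for j
  proof (induction j)
    case 0
    show ?case
      by (simp add: w_def jacobi[of E F] tri u(3) Eu br.zero_right)
  next
    case (Suc j)
    have "br E (w (Suc (Suc j))) = br h (w (Suc j)) + br F (br E (w (Suc j)))"
      by (simp only: w_Suc[of "Suc j"] jacobi[of E F] tri)
    also have "\<dots> = (2 * of_nat m - 2 * of_nat (Suc j)) *s w (Suc j) +
        (of_nat (Suc j) * (2 * of_nat m - of_nat j)) *s w (Suc j)"
      by (simp only: hw Suc br_smult_right w_Suc[of j, symmetric])
    also have "\<dots> = (of_nat (Suc (Suc j)) * (2 * of_nat m - of_nat (Suc j))) *s w (Suc j)"
      unfolding vec.scale_left_distrib[symmetric]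
      by (rule arg_cong[where f="\<lambda>c. c *s w (Suc j)"]) (simp add: algebra_simps)
    finally show ?case .
  qed
  \<comment> \<open>\<open>w m\<close> has weight zero and so vanishes. Raising descends from there
    to \<open>w 0\<close>, which is \<open>u\<close>; the coefficient is nonzero because i <
    m.\<close>
  have "w (m - j) = 0" if "j \<le> m" for j
    using that
  proof (induction j)
    case 0
    show ?case using no_zero[OF wR] hw[of m] by simp
  next
    case (Suc j)
    define i where "i = m - Suc j"
    have i: "Suc i = m - j" "i < m" using Suc.prems by (auto simp: i_def)
    have "(of_nat (Suc i) * (2 * of_nat m - of_nat i)) *s w i = 0"
      using Ew[of i] Suc i(1) by (simp add: br.zero_right)
    moreover have "2 * of_nat m - of_nat i \<noteq> (0 :: complex)"
    proof -
      have "(of_nat (2 * m) :: complex) \<noteq> of_nat i" using i(2) by (subst of_nat_eq_iff) simp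
      then show ?thesis by simp
    qed
    ultimately show ?case unfolding i_def[symmetric] by (simp del: of_nat_Suc)
  qed
  from this[of m] u(2) show False by (simp add: w_def)
qed

end

section \<open>Weights of a Cartan subalgebra on stable subspaces\<close>

locale cartan = lie_alg br for br :: "'n::finite bracket" +
  fixes t :: "(complex ^ 'n) set"
  assumes cartan: "cartan_subalgebra br t"
begin

lemma t_subspace: "vec.subspace t" and t_abelian: "x \<in> t \<Longrightarrow> y \<in> t \<Longrightarrow> br x y = 0"
  and t_maximal: "abelian_subalgebra br s \<Longrightarrow> t \<subseteq> s \<Longrightarrow> s = t"
  and t_semisimple: "k \<in> t \<Longrightarrow> vec.span {y. \<exists>c. br k y = c *s y} = UNIV"
  using cartan unfolding cartan_subalgebra_def abelian_subalgebra_def ad_semisimple_def by blast+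

lemma br_commute: "x \<in> t \<Longrightarrow> y \<in> t \<Longrightarrow> br x (br y v) = br y (br x v)"
  using jacobi[of x y v] t_abelian[of x y] by (simp add: br.zero_left)

lemma stable_decomposition:
  assumes "k \<in> t" "vec.subspace W" "\<And>w. w \<in> W \<Longrightarrow> br k w \<in> W" "w \<in> W"
  shows "\<exists>C e. finite C \<and> (\<forall>c\<in>C. br k (e c) = c *s e c \<and> e c \<in> W) \<and> w = (\<Sum>c\<in>C. e c)"
proof -
  obtain C e where C: "finite C" "\<forall>c\<in>C. br k (e c) = c *s e c" "w = (\<Sum>c\<in>C. e c)"
    using eigenvector_decomposition[OF br_linear(1) t_semisimple[OF assms(1)]] by metis
  have "\<forall>c\<in>C. e c \<in> W"
    by (rule eigenvector_components[OF br_linear(1) assms(2,3) C(1)]) (use C assms(4) in auto)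
  with C show ?thesis by blast
qed

definition t_stable :: "(complex ^ 'n) set \<Rightarrow> bool" where
  "t_stable W \<longleftrightarrow> vec.subspace W \<and> (\<forall>k\<in>t. \<forall>w\<in>W. br k w \<in> W)"

lemma t_stable_eigenspace:
  assumes "t_stable W" "k \<in> t"
  shows "t_stable (W \<inter> {v. br k v = c *s v})"
  using assms subspace_eigenspace[of k c]
  by (auto simp: t_stable_def vec.subspace_inter br_commute[of k] br_smult_right)

lemma t_stable_UNIV: "t_stable UNIV"
  by (simp add: t_stable_def)

text \<open>Induction on dimension: if some \<open>k\<close> does not act on \<open>w\<close> by a
  scalar, a nonzero eigencomponent of \<open>w\<close> lies in a proper subspace of
  \<open>W\<close>, which is stable because \<open>t\<close> is abelian.\<close>

lemma common_eigenvector: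
  assumes "t_stable W" "w \<in> W" "w \<noteq> 0"
  shows "\<exists>v\<in>W. v \<noteq> 0 \<and> (\<forall>k\<in>t. \<exists>c. br k v = c *s v)"
  using assms
proof (induction "vec.dim W" arbitrary: W w rule: less_induct)
  case less
  show ?case
  proof (cases "\<forall>k\<in>t. \<exists>c. br k w = c *s w")
    case False
    then obtain k where k: "k \<in> t" "\<And>c. br k w \<noteq> c *s w" by blast
    have W: "vec.subspace W" "\<And>v. v \<in> W \<Longrightarrow> br k v \<in> W"
      using less.prems(1) k(1) by (auto simp: t_stable_def)
    obtain C e where C: "finite C" "\<And>c. c \<in> C \<Longrightarrow> br k (e c) = c *s e c \<and> e c \<in> W" "w = (\<Sum>c\<in>C. e c)"
      using stable_decomposition[OF k(1) W less.prems(2)] by blast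
    obtain c where c: "c \<in> C" "e c \<noteq> 0"
      using C(3) less.prems(3) sum.neutral by metis
    let ?W = "W \<inter> {v. br k v = c *s v}"
    have st: "t_stable ?W" using t_stable_eigenspace[OF less.prems(1) k(1)] .
    have "?W \<subset> W" using k(2) less.prems(2) by blast
    then have "vec.dim ?W < vec.dim W"
      using st W(1) vec.span_eq_iff unfolding t_stable_def by (metis vec.dim_psubset)
    from less.hyps[OF this st, of "e c"] C(2)[OF c(1)] c(2) show ?thesis by blast
  qed (use less.prems in blast)
qed

text \<open>As \<open>v\<close> is nonzero, its eigenvalues form a linear functional on
  \<open>t\<close>, which is either zero or a root.\<close>

lemma weight_cases:
  assumes "v \<noteq> 0" "\<forall>k\<in>t. \<exists>c. br k v = c *s v"
  shows "(\<forall>k\<in>t. br k v = 0) \<or> (\<exists>\<beta>. is_root br t \<beta> \<and> v \<in> root_space br t \<beta>)"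
proof -
  obtain \<beta> where \<beta>: "\<And>k. k \<in> t \<Longrightarrow> br k v = \<beta> k *s v" using assms(2) by metis
  have "\<beta> (a *s x + b *s y) = a * \<beta> x + b * \<beta> y" if "x \<in> t" "y \<in> t" for a b x y
  proof -
    have "a *s x + b *s y \<in> t"
      using t_subspace that by (simp add: vec.subspace_add vec.subspace_scale)
    from \<beta>[OF this] have "\<beta> (a *s x + b *s y) *s v = (a * \<beta> x + b * \<beta> y) *s v"
      using that by (simp add: br.add_left br_smult_left \<beta> vec.scale_left_distrib)
    then show ?thesis using assms(1) by (simp only: vec.scale_cancel_right) simp
  qed
  moreover have "v \<in> root_space br t \<beta>" by (simp add: root_space_def \<beta>)
  ultimately show ?thesis
    using assms(1) \<beta> unfolding is_root_def by (metis vec.scale_zero_left)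
qed

lemma weight_vector_in:
  assumes "t_stable W" "w \<in> W" "w \<noteq> 0"
  shows "(\<exists>v\<in>W. v \<noteq> 0 \<and> (\<forall>k\<in>t. br k v = 0)) \<or>
    (\<exists>v\<in>W. \<exists>\<beta>. v \<noteq> 0 \<and> is_root br t \<beta> \<and> v \<in> root_space br t \<beta>)"
  using common_eigenvector[OF assms] weight_cases by metis

text \<open>The eigenspace of \<open>k\<close> inside \<open>W\<close> is again stable, so it
  contains a weight vector from which \<open>c\<close> can be read off.\<close>

lemma eigenvalue_cases:
  assumes "k \<in> t" "t_stable W" "v \<in> W" "v \<noteq> 0" "br k v = c *s v"
  shows "c = 0 \<or> (\<exists>u\<in>W. \<exists>\<beta>. u \<noteq> 0 \<and> is_root br t \<beta> \<and> u \<in> root_space br t \<beta> \<and> c = \<beta> k)"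
proof -
  let ?W = "W \<inter> {v. br k v = c *s v}"
  have "t_stable ?W" using t_stable_eigenspace assms by blast
  from weight_vector_in[OF this, of v] assms(3-5) consider
      u where "u \<in> ?W" "u \<noteq> 0" "\<forall>k\<in>t. br k u = 0"
    | u \<beta> where "u \<in> ?W" "u \<noteq> 0" "is_root br t \<beta>" "u \<in> root_space br t \<beta>"
    by auto
  then show ?thesis
  proof cases
    case 1
    then have "c *s u = 0" using assms(1) by auto
    then show ?thesis using 1(2) by simp
  next
    case 2
    then have "c *s u = \<beta> k *s u" using assms(1) by (auto simp: root_space_def)
    then have "c = \<beta> k" using 2(2) by simp
    with 2 show ?thesis by blast
  qed
qed

text \<open>\<open>k\<close> is diagonalizable on \<open>W\<close>, and its eigenvalues there are
  zero or values at \<open>k\<close> of roots with root vectors in \<open>W\<close>.\<close>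

lemma annihilates_if_roots_vanish:
  assumes "k \<in> t" "t_stable W" "w \<in> W"
    and "\<And>u \<beta>. u \<in> W \<Longrightarrow> u \<noteq> 0 \<Longrightarrow> is_root br t \<beta> \<Longrightarrow> u \<in> root_space br t \<beta> \<Longrightarrow> \<beta> k = 0"
  shows "br k w = 0"
proof -
  obtain C e where C: "finite C" "\<And>c. c \<in> C \<Longrightarrow> br k (e c) = c *s e c \<and> e c \<in> W" "w = (\<Sum>c\<in>C. e c)"
    using stable_decomposition[OF assms(1) _ _ assms(3)] assms(1,2) unfolding t_stable_def by blast
  have "br k (e c) = 0" if "c \<in> C" for c
    using eigenvalue_cases[OF assms(1,2), of "e c" c] C(2)[OF that] assms(4)
    by (cases "e c = 0") auto
  then show ?thesis using C(3) by (simp add: br.sum_right)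
qed

text \<open>Adjoining \<open>w\<close> to \<open>t\<close> keeps the subalgebra abelian, so
  maximality forces \<open>w\<close> into \<open>t\<close>.\<close>

lemma self_centralizing:
  assumes "\<forall>k\<in>t. br k w = 0"
  shows "w \<in> t"
proof -
  let ?s = "{a + c *s w | a c. a \<in> t}"
  have "abelian_subalgebra br ?s"
    unfolding abelian_subalgebra_def
  proof (intro conjI ballI vec.subspaceI)
    show "0 \<in> ?s" using vec.subspace_0[OF t_subspace] by (auto intro!: exI[of _ 0])
  next
    fix x y assume "x \<in> ?s" "y \<in> ?s"
    then obtain a c b d where "x = a + c *s w" "y = b + d *s w" "a \<in> t" "b \<in> t" by blast
    then show "x + y \<in> ?s"
      using vec.subspace_add[OF t_subspace, of a b]
      by (auto intro!: exI[of _ "a + b"] exI[of _ "c + d"] simp: vec.scale_left_distrib)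
  next
    fix r x assume "x \<in> ?s"
    then obtain a c where "x = a + c *s w" "a \<in> t" by blast
    then show "r *s x \<in> ?s"
      using vec.subspace_scale[OF t_subspace, of a r]
      by (auto intro!: exI[of _ "r *s a"] exI[of _ "r * c"] simp: vec.scale_right_distrib)
  next
    fix x y assume "x \<in> ?s" "y \<in> ?s"
    then obtain a c b d where "x = a + c *s w" "y = b + d *s w" "a \<in> t" "b \<in> t" by blast
    then show "br x y = 0"
      using assms t_abelian[of a b] br_skew[of w b]
      by (simp add: br.add_left br.add_right br_smult_left br_smult_right)
  qed
  moreover have "t \<subseteq> ?s"
  proof
    fix x assume "x \<in> t"
    then show "x \<in> ?s" by (intro CollectI exI[of _ x] exI[of _ 0]) simp
  qed
  ultimately have "?s = t" by (rule t_maximal)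
  moreover have "w \<in> ?s"
    using vec.subspace_0[OF t_subspace] by (intro CollectI exI[of _ 0] exI[of _ 1]) simp
  ultimately show ?thesis by simp
qed

end

section \<open>The principal \<ss>\<ll>2-triple and the radical of the Killing form\<close>

locale principal_triple = cartan br t for br :: "'n::finite bracket" and t +
  fixes \<Delta> :: "(complex ^ 'n \<Rightarrow> complex) set" and h \<xi> \<eta> :: "complex ^ 'n"
    and e_pos e_neg :: "(complex ^ 'n \<Rightarrow> complex) \<Rightarrow> complex ^ 'n"
  assumes semisimple: "semisimple_lie_algebra br"
    and simple: "simple_roots br t \<Delta>"
    and e_pos: "\<alpha> \<in> \<Delta> \<Longrightarrow> e_pos \<alpha> \<in> root_space br t \<alpha>"
    and e_pairing: "\<alpha> \<in> \<Delta> \<Longrightarrow> killing br (e_pos \<alpha>) (e_neg \<alpha>) = 1"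
    and h_in: "h \<in> t"
    and simple_h: "\<alpha> \<in> \<Delta> \<Longrightarrow> \<alpha> h = - 2"
    and triple: "sl2_triple br \<xi> h \<eta>"
begin

lemma root_expansion:
  assumes "is_root br t \<beta>"
  obtains m :: "(complex ^ 'n \<Rightarrow> complex) \<Rightarrow> nat" and s :: complex
  where "s \<in> {1, -1}" "\<And>k. k \<in> t \<Longrightarrow> \<beta> k = s * (\<Sum>\<alpha>\<in>\<Delta>. of_nat (m \<alpha>) * \<alpha> k)"
proof -
  obtain m :: "(complex ^ 'n \<Rightarrow> complex) \<Rightarrow> nat" where
    "(\<forall>k\<in>t. \<beta> k = (\<Sum>\<alpha>\<in>\<Delta>. of_nat (m \<alpha>) * \<alpha> k)) \<or> (\<forall>k\<in>t. \<beta> k = - (\<Sum>\<alpha>\<in>\<Delta>. of_nat (m \<alpha>) * \<alpha> k))"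
    using simple assms unfolding simple_roots_def by blast
  then show thesis using that[of 1 m] that[of "-1" m] by auto
qed

text \<open>The coefficients of a root in simple roots share one sign, so its value at
  \<open>h\<close> is -2 times its height; the height is nonzero because a root is.\<close>

lemma root_h:
  assumes "is_root br t \<beta>"
  shows "\<exists>n>0. \<beta> h = 2 * of_nat n \<or> \<beta> h = - (2 * of_nat n)"
proof -
  obtain m s where s: "s \<in> {1, -1}" and m: "\<And>k. k \<in> t \<Longrightarrow> \<beta> k = s * (\<Sum>\<alpha>\<in>\<Delta>. of_nat (m \<alpha>) * \<alpha> k)"
    by (rule root_expansion[OF assms]) (rule that)
  have fin: "finite \<Delta>" using simple by (simp add: simple_roots_def)
  have hsum: "(\<Sum>\<alpha>\<in>\<Delta>. of_nat (m \<alpha>) * \<alpha> h) = - (2 * of_nat (\<Sum>\<alpha>\<in>\<Delta>. m \<alpha>))"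
    by (simp add: simple_h sum_negf sum_distrib_left mult.commute)
  have pos: "(\<Sum>\<alpha>\<in>\<Delta>. m \<alpha>) > 0"
  proof (rule ccontr)
    assume "\<not> (\<Sum>\<alpha>\<in>\<Delta>. m \<alpha>) > 0"
    then have "\<forall>\<alpha>\<in>\<Delta>. m \<alpha> = 0" using fin by simp
    then have "\<forall>k\<in>t. \<beta> k = 0" by (simp add: m)
    with assms show False by (auto simp: is_root_def)
  qed
  have "\<beta> h = 2 * of_nat n \<or> \<beta> h = - (2 * of_nat n)" if "\<beta> h = s * - (2 * of_nat n)" for n
    using s that by auto
  from this[OF m[OF h_in, unfolded hsum]] pos show ?thesis by blast
qed

text \<open>\<open>h\<close> is regular: no root vanishes at it, hence only weight zero occurs on
  its centralizer and \<open>t\<close> annihilates that subspace.\<close>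

lemma centralizer_h: "br h v = 0 \<Longrightarrow> v \<in> t"
proof (intro self_centralizing ballI)
  fix k assume v: "br h v = 0" and k: "k \<in> t"
  let ?W = "UNIV \<inter> {v. br h v = 0 *s v}"
  show "br k v = 0"
  proof (rule annihilates_if_roots_vanish[OF k t_stable_eigenspace[OF t_stable_UNIV h_in, of 0]])
    fix u \<beta> assume u: "u \<in> ?W" "u \<noteq> 0" "is_root br t \<beta>" "u \<in> root_space br t \<beta>"
    then have "\<beta> h *s u = 0" using h_in by (auto simp: root_space_def)
    then have "\<beta> h = 0" using u(2) by simp
    with root_h[OF u(3)] show "\<beta> k = 0" by auto
  qed (simp add: v)
qed

lemma eigenvalue_h:
  assumes "v \<noteq> 0" "br h v = c *s v"
  shows "c = 0 \<or> (\<exists>n>0. c = 2 * of_nat n \<or> c = - (2 * of_nat n))"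
  using eigenvalue_cases[OF h_in t_stable_UNIV _ assms] root_h by blast

text \<open>The center is an abelian ideal, hence solvable after one derivation step.\<close>

lemma center_trivial:
  assumes "\<And>y. br z y = 0"
  shows "z = 0"
proof -
  let ?I = "{z. \<forall>y. br z y = 0}"
  have sub: "vec.subspace ?I"
    by (simp add: vec.subspace_def br.zero_left br.add_left br_smult_left)
  have "br x y = 0" if "y \<in> ?I" for x y
    using that br_skew[of x y] by simp
  then have "lie_ideal br ?I"
    using sub by (auto simp: lie_ideal_def br.zero_left)
  moreover have "{br x y | x y. x \<in> ?I \<and> y \<in> ?I} \<subseteq> {0}" by auto
  then have "derived_subalgebra br ?I \<subseteq> {0}"
    unfolding derived_subalgebra_def by (rule vec.span_minimal) (rule vec.subspace_single_0)
  then have "derived_subalgebra br ?I = {0}"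
    unfolding derived_subalgebra_def using vec.span_zero by blast
  then have "solvable_subalgebra br ?I"
    unfolding solvable_subalgebra_def by (intro exI[of _ 1]) simp
  ultimately have "?I = {0}" using semisimple unfolding semisimple_lie_algebra_def by blast
  with assms show ?thesis by blast
qed

text \<open>Pairing root vectors shows that every simple root vanishes at \<open>z\<close>. Then all
  roots do, so \<open>z\<close> acts by zero on every weight vector and is central.\<close>

lemma killing_radical_inter_t:
  assumes "z \<in> t" "\<And>y. killing br z y = 0"
  shows "z = 0"
proof (rule center_trivial)
  have simple0: "\<alpha> z = 0" if "\<alpha> \<in> \<Delta>" for \<alpha>
  proof -
    have "\<alpha> z = killing br (br z (e_pos \<alpha>)) (e_neg \<alpha>)"
      using e_pos[OF that] e_pairing[OF that] assms(1) by (simp add: root_space_def killing_smult_left)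
    also have "\<dots> = 0" by (simp add: killing_invariant assms(2))
    finally show ?thesis .
  qed
  fix y
  show "br z y = 0"
  proof (rule annihilates_if_roots_vanish[OF assms(1) t_stable_UNIV])
    fix \<beta> assume "is_root br t \<beta>"
    from root_expansion[OF this] obtain m :: "(complex ^ 'n \<Rightarrow> complex) \<Rightarrow> nat" and s :: complex
      where "\<And>k. k \<in> t \<Longrightarrow> \<beta> k = s * (\<Sum>\<alpha>\<in>\<Delta>. of_nat (m \<alpha>) * \<alpha> k)"
      by blast
    then show "\<beta> z = 0" using assms(1) by (simp add: simple0)
  qed simp
qed

lemma killing_radical_trivial:
  assumes "\<And>y. killing br x y = 0"
  shows "x = 0"
proof -
  let ?R = "{x. \<forall>y. killing br x y = 0}"
  have sub: "vec.subspace ?R"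
    by (simp add: vec.subspace_def killing.zero_left killing.add_left killing_smult_left)
  have R: "br a r \<in> ?R" if "r \<in> ?R" for a r
    using that by (simp add: br_skew[of a r] killing.minus_left killing_invariant)
  have tri: "br \<xi> \<eta> = h" "br h \<xi> = 2 *s \<xi>" "br h \<eta> = (- 2) *s \<eta>"
    using triple by (auto simp: sl2_triple_def)
  \<comment> \<open>The reversed triple has neutral element -h and turns the negative weights of
    \<open>h\<close> into positive ones, so one lemma covers both signs.\<close>
  have tri': "br \<eta> \<xi> = - h" "br (- h) \<eta> = 2 *s \<eta>" "br (- h) \<xi> = (- 2) *s \<xi>"
    using tri by (simp_all add: br_skew[of \<eta>] br.minus_left)
  have mh: "- h \<in> t" using vec.subspace_neg[OF t_subspace h_in] .
  have zero: "v = 0" if "v \<in> ?R" "br h v = 0" for v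
    using killing_radical_inter_t[OF centralizer_h[OF that(2)]] that(1) by simp
  \<comment> \<open>The radical is an ideal, so the \<open>h\<close>-eigencomponents of
    \<open>x\<close> stay in it and can be killed one at a time.\<close>
  obtain C e where C: "finite C" "\<And>c. c \<in> C \<Longrightarrow> br h (e c) = c *s e c \<and> e c \<in> ?R" "x = (\<Sum>c\<in>C. e c)"
    using stable_decomposition[OF h_in sub R, of x] assms by blast
  have "e c = 0" if "c \<in> C" for c
  proof (rule ccontr)
    assume "e c \<noteq> 0"
    from C(2)[OF that] have c: "br h (e c) = c *s e c" "e c \<in> ?R" by auto
    consider "c = 0" | n where "n > 0" "c = 2 * of_nat n" | n where "n > 0" "c = - (2 * of_nat n)"
      using eigenvalue_h[OF \<open>e c \<noteq> 0\<close> c(1)] by blast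
    then have "e c = 0"
    proof cases
      case 1
      then show ?thesis using zero[OF c(2)] c(1) by simp
    next
      case (2 n)
      show ?thesis
        by (rule sl2_positive_even_weight[OF tri R zero finite_eigenvalues[OF br_linear(1) t_semisimple[OF h_in]] c(2) _ 2(1)])
          (use c(1) 2(2) in auto)
    next
      case (3 n)
      show ?thesis
        by (rule sl2_positive_even_weight[OF tri' R _ finite_eigenvalues[OF br_linear(1) t_semisimple[OF mh]] c(2) _ 3(1)])
          (use c(1) 3(2) zero in \<open>auto simp: br.minus_left\<close>)
    qed
    with \<open>e c \<noteq> 0\<close> show False ..
  qed
  with C(3) show ?thesis by simp
qed

sublocale killing_nondegenerate br
  by unfold_locales (rule killing_radical_trivial)

end

section \<open>From the Lie-theoretic data to the pullback formula\<close>

theorem proposition8: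
  fixes br :: "'n::finite bracket"
    and t :: "(complex ^ 'n) set"
    and f :: "'r::finite \<Rightarrow> complex ^ 'n \<Rightarrow> complex"
    and \<Delta> :: "(complex ^ 'n \<Rightarrow> complex) set"
    and e_pos e_neg :: "(complex ^ 'n \<Rightarrow> complex) \<Rightarrow> complex ^ 'n"
    and c :: "(complex ^ 'n \<Rightarrow> complex) \<Rightarrow> complex"
    and h \<xi> \<eta> :: "complex ^ 'n"
    and S :: "(complex ^ 'n) set"
  assumes "semisimple_lie_algebra br"
    and "cartan_subalgebra br t"
    and "CARD('r) = vec.dim t"
    and "\<And>i. homogeneous (f i)"
    and "algebraically_independent f"
    and "invariants_generated_by br f"
    and "simple_roots br t \<Delta>"
    and "\<And>\<alpha>. \<alpha> \<in> \<Delta> \<Longrightarrow> e_pos \<alpha> \<in> root_space br t \<alpha>"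
    and "\<And>\<alpha>. \<alpha> \<in> \<Delta> \<Longrightarrow> e_neg \<alpha> \<in> root_space br t (\<lambda>k. - \<alpha> k)"
    and "\<And>\<alpha>. \<alpha> \<in> \<Delta> \<Longrightarrow> killing br (e_pos \<alpha>) (e_neg \<alpha>) = 1"
    and "h \<in> t"
    and "\<And>\<alpha>. \<alpha> \<in> \<Delta> \<Longrightarrow> \<alpha> h = - 2"
    and "\<xi> = (\<Sum>\<alpha>\<in>\<Delta>. e_neg \<alpha>)"
    and "\<And>\<alpha>. \<alpha> \<in> \<Delta> \<Longrightarrow> c \<alpha> \<noteq> 0"
    and "\<eta> = (\<Sum>\<alpha>\<in>\<Delta>. c \<alpha> *s e_pos \<alpha>)"
    and "sl2_triple br \<xi> h \<eta>"
    and "S = kostant_slice br \<xi> \<eta>"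
  shows "Phi_map br f ` (UNIV \<times> S) \<subseteq> universal_centralizer br S \<and>
         Phi_map br f differentiable_on (UNIV \<times> S) \<and>
         forms_agree_on (UNIV \<times> S)
           (pullback_form (UNIV \<times> S) (Phi_map br f) (omega_form br S)) (nu_form f S)"
proof -
  have lie: "lie_algebra br" and tri: "principal_triple br t \<Delta> h \<xi> \<eta> e_pos e_neg"
  proof -
    show lie: "lie_algebra br"
      using assms(1) by (simp add: semisimple_lie_algebra_def)
    show "principal_triple br t \<Delta> h \<xi> \<eta> e_pos e_neg"
      by unfold_locales (fact lie assms)+
  qed
  interpret principal_triple br t \<Delta> h \<xi> \<eta> e_pos e_neg by (rule tri)
  have inv: "invariant_poly br (f i)" for i
    using assms(6) by (simp add: invariants_generated_by_def)
  then have "\<forall>i. \<exists>D H. (\<forall>x. (f i has_derivative D x) (at x)) \<and> (\<forall>x c z. D x (c *s z) = c * D x z) \<and>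
      (\<forall>x z. ((\<lambda>x. D x z) has_derivative H x z) (at x)) \<and> (\<forall>x z w. H x z w = H x w z)"
    by (intro allI poly_fun_derivatives) (simp add: invariant_poly_def)
  \<comment> \<open>Differentials and Hessians exist separately for each generator; choice gathers
    them into families indexed by i.\<close>
  from choice[OF this] obtain D where
    "\<forall>i. \<exists>H. (\<forall>x. (f i has_derivative D i x) (at x)) \<and> (\<forall>x c z. D i x (c *s z) = c * D i x z) \<and>
      (\<forall>x z. ((\<lambda>x. D i x z) has_derivative H x z) (at x)) \<and> (\<forall>x z w. H x z w = H x w z)"
    by (elim exE)
  from choice[OF this] obtain H where
    DH: "\<forall>i. (\<forall>x. (f i has_derivative D i x) (at x)) \<and> (\<forall>x c z. D i x (c *s z) = c * D i x z) \<and>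
      (\<forall>x z. ((\<lambda>x. D i x z) has_derivative H i x z) (at x)) \<and> (\<forall>x z w. H i x z w = H i x w z)"
    by (elim exE)
  interpret invariant_functions br f D H
  proof unfold_locales
    show "f i (Ad y s *v x) = f i x" for i y s x
      using inv[of i] Ad_in_adjoint_group[of y s] by (simp add: invariant_poly_def)
    show "H i x z w = H i x w z" for i x z w
      using DH by blast
  qed (simp_all add: DH)
  show ?thesis using Phi_map_pullback[of S] by blast
qed

end
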